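(* Let $A$ and $B$ be groups in $\mathcal{N}_2$, and let $D$ be a common subgroup of $A$ and $B$. Assume further that $D$ is co-central in $B$. Then there exists a (weak) amalgam of $A$ and $B$ over $D$ in $\mathcal{N}_2$ if and only if the following condition holds: for every integer $q>0$, every $a\in A$ with $a^q\in A_2D$, and every $z\in Z(B)$ with $z^q\in D$, we have $[a,z^q]=e$ (the commutator being computed in $A$, where $z^q \in D\subseteq A$).
   Context: $\mathcal{N}_2$ denotes the variety of nilpotent groups of class (at most) two, that is, the class of all groups $G$ such that $[G,G]\subseteq Z(G)$, where $Z(G)$ is the center of $G$. The commutator is $[x,y]=x^{-1}y^{-1}xy$, and $e$ denotes the identity element. $A_2=[A,A]$ denotes the commutator subgroup of $A$, and $A_2D=\{a'd : a'\in A_2,\ d\in D\}$. "$D$ is a common subgroup of $A$ and $B$" means that $D$ is a group which is a subgroup of both $A$ and $B$ (equivalently, $D$ is given with fixed embeddings into $A$ and into $B$, by which it is identified with its images). A (weak) amalgam of $A$ and $B$ over $D$ in $\mathcal{N}_2$ is a group $G\in\mathcal{N}_2$ such that $A$ and $B$ are subgroups of $G$ and $D\subseteq A\cap B$ inside $G$; that is, a group $G\in\mathcal{N}_2$ together with injective homomorphisms $A\to G$ and $B\to G$ which agree on $D$. (It is not required that the intersection of the images of $A$ and $B$ be equal to the image of $D$.) A subgroup $X$ of a group $B$ is co-central in $B$ if there exists a central subgroup $Z$ of $B$ such that $\langle X,Z\rangle=B$; equivalently, $\langle X,Z(B)\rangle=B$. *)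

theory Defs
  imports "HOL-Algebra.Generated_Groups"
begin

definition center :: "('a, 'b) monoid_scheme \<Rightarrow> 'a set" where
  "center G = {z \<in> carrier G. \<forall>x\<in>carrier G. z \<otimes>\<^bsub>G\<^esub> x = x \<otimes>\<^bsub>G\<^esub> z}"

definition commutator :: "('a, 'b) monoid_scheme \<Rightarrow> 'a \<Rightarrow> 'a \<Rightarrow> 'a" where
  "commutator G x y = inv\<^bsub>G\<^esub> x \<otimes>\<^bsub>G\<^esub> inv\<^bsub>G\<^esub> y \<otimes>\<^bsub>G\<^esub> x \<otimes>\<^bsub>G\<^esub> y"

text \<open>The library's \<open>derived_set\<close> uses the opposite commutator convention
  \<open>x y x\<inverse> y\<inverse>\<close>; on a whole group this makes no difference.\<close>

lemma (in group) derived_eq_generate_commutators: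
  "derived G (carrier G) =
     generate G {commutator G x y | x y. x \<in> carrier G \<and> y \<in> carrier G}"
proof -
  have "derived_set G (carrier G) =
        {commutator G x y | x y. x \<in> carrier G \<and> y \<in> carrier G}" (is "?L = ?R")
  proof (intro equalityI subsetI)
    fix u assume "u \<in> ?L"
    then obtain h k where "h \<in> carrier G" "k \<in> carrier G" "u = h \<otimes> k \<otimes> inv h \<otimes> inv k"
      by auto
    then have "u = commutator G (inv h) (inv k)" "inv h \<in> carrier G" "inv k \<in> carrier G"
      by (simp_all add: commutator_def)
    then show "u \<in> ?R" by blast
  next
    fix u assume "u \<in> ?R"
    then obtain x y where xy: "x \<in> carrier G" "y \<in> carrier G" "u = commutator G x y"
      by auto
    then have "u = inv x \<otimes> inv y \<otimes> inv (inv x) \<otimes> inv (inv y)"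
      by (simp add: commutator_def)
    moreover have "inv x \<in> carrier G" "inv y \<in> carrier G" using xy by simp_all
    ultimately show "u \<in> ?L" by blast
  qed
  then show ?thesis by (simp add: derived_def)
qed

definition nilpotent_class2 :: "('a, 'b) monoid_scheme \<Rightarrow> bool" where
  "nilpotent_class2 G \<longleftrightarrow> group G \<and> derived G (carrier G) \<subseteq> center G"

definition cocentral :: "'a set \<Rightarrow> ('a, 'b) monoid_scheme \<Rightarrow> bool" where
  "cocentral S B \<longleftrightarrow>
     (\<exists>Z. subgroup Z B \<and> Z \<subseteq> center B \<and> generate B (S \<union> Z) = carrier B)"

text \<open>The common subgroup \<open>D\<close> is given by embeddings \<open>i\<close> into \<open>A\<close> and \<open>j\<close> into \<open>B\<close>;
  the amalgam \<open>G\<close> is given with embeddings \<open>f\<close> of \<open>A\<close> and \<open>g\<close> of \<open>B\<close>. Nothing is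
  required of the intersection of the images of \<open>f\<close> and \<open>g\<close> beyond containing \<open>D\<close>.\<close>

definition weak_amalgam ::
  "('a, 'r) monoid_scheme \<Rightarrow> ('b, 's) monoid_scheme \<Rightarrow> ('d, 't) monoid_scheme \<Rightarrow>
   ('d \<Rightarrow> 'a) \<Rightarrow> ('d \<Rightarrow> 'b) \<Rightarrow> ('g, 'u) monoid_scheme \<Rightarrow> ('a \<Rightarrow> 'g) \<Rightarrow> ('b \<Rightarrow> 'g) \<Rightarrow> bool" where
  "weak_amalgam A B D i j G f g \<longleftrightarrow>
     nilpotent_class2 G \<and> f \<in> mon A G \<and> g \<in> mon B G \<and>
     (\<forall>d\<in>carrier D. f (i d) = g (j d))"

text \<open>HOL cannot quantify existentially over types, so existence of an amalgam is expressed
  with amalgams whose elements are words over \<open>A\<close> and \<open>B\<close>. This loses nothing: by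
  \<open>amalgam_existsI\<close> below, an amalgam over any type whatsoever yields one of this form, since
  the subgroup generated by the images of \<open>A\<close> and \<open>B\<close> is again an amalgam and each of its
  elements is the value of a word.\<close>

definition amalgam_exists ::
  "('a, 'r) monoid_scheme \<Rightarrow> ('b, 's) monoid_scheme \<Rightarrow> ('d, 't) monoid_scheme \<Rightarrow>
   ('d \<Rightarrow> 'a) \<Rightarrow> ('d \<Rightarrow> 'b) \<Rightarrow> bool" where
  "amalgam_exists A B D i j \<longleftrightarrow>
     (\<exists>(G :: ('a + 'b) list monoid) f g. weak_amalgam A B D i j G f g)"

lemma nilpotent_class2_iso_subgroup:
  assumes G: "nilpotent_class2 G" and H: "subgroup H G" and K: "group K"
    and e: "e \<in> iso (G\<lparr>carrier := H\<rparr>) K"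
  shows "nilpotent_class2 K"
proof -
  interpret G: group G using G by (simp add: nilpotent_class2_def)
  have gH: "group (G\<lparr>carrier := H\<rparr>)" using H by (simp add: G.subgroup_imp_group)
  have eh: "e \<in> hom (G\<lparr>carrier := H\<rparr>) K" and im: "e ` H = carrier K"
    using e by (auto simp: iso_def bij_betw_def)
  interpret E: group_hom "G\<lparr>carrier := H\<rparr>" K e
    using gH K eh by (simp add: group_hom_def group_hom_axioms_def)
  have HG: "H \<subseteq> carrier G" using H by (rule subgroup.subset)
  have "derived K (carrier K) = e ` derived (G\<lparr>carrier := H\<rparr>) H"
    using E.derived_img[of H] im by simp
  also have "derived (G\<lparr>carrier := H\<rparr>) H = derived G H"
    using G.derived_consistent[OF subset_refl H] by simp
  finally have dK: "derived K (carrier K) = e ` derived G H" .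
  have dH: "derived G H \<subseteq> H" using G.derived_incl[OF subset_refl H] .
  have dZ: "derived G H \<subseteq> center G"
    using G.mono_derived[OF HG] G by (auto simp: nilpotent_class2_def)
  have "e u \<in> center K" if u: "u \<in> derived G H" for u
  proof -
    have uH: "u \<in> H" using u dH by blast
    have "e u \<otimes>\<^bsub>K\<^esub> x = x \<otimes>\<^bsub>K\<^esub> e u" if x: "x \<in> carrier K" for x
    proof -
      obtain h where h: "h \<in> H" "x = e h" using x im by blast
      have "u \<otimes>\<^bsub>G\<^esub> h = h \<otimes>\<^bsub>G\<^esub> u" using u dZ h HG by (auto simp: center_def)
      moreover have "e (u \<otimes>\<^bsub>G\<^esub> h) = e u \<otimes>\<^bsub>K\<^esub> e h" "e (h \<otimes>\<^bsub>G\<^esub> u) = e h \<otimes>\<^bsub>K\<^esub> e u"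
        using hom_mult[OF eh, of u h] hom_mult[OF eh, of h u] uH h by simp_all
      ultimately show ?thesis using h by simp
    qed
    moreover have "e u \<in> carrier K" using uH im by blast
    ultimately show ?thesis by (simp add: center_def)
  qed
  then show ?thesis using dK K by (auto simp: nilpotent_class2_def)
qed

lemma amalgam_existsI:
  fixes A :: "('a, 'r) monoid_scheme" and B :: "('b, 's) monoid_scheme"
    and D :: "('d, 't) monoid_scheme" and G :: "('g, 'u) monoid_scheme"
  assumes A: "group A" and B: "group B"
    and i: "i \<in> mon D A" and j: "j \<in> mon D B"
    and am: "weak_amalgam A B D i j G f g"
  shows "amalgam_exists A B D i j"
proof -
  have G: "nilpotent_class2 G" and f: "f \<in> hom A G" "inj_on f (carrier A)"
    and g: "g \<in> hom B G" "inj_on g (carrier B)"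
    and fg: "\<And>d. d \<in> carrier D \<Longrightarrow> f (i d) = g (j d)"
    using am by (auto simp: weak_amalgam_def mon_def)
  interpret G: group G using G by (simp add: nilpotent_class2_def)
  interpret F: group_hom A G f
    using A f G.is_group by (simp add: group_hom_def group_hom_axioms_def)
  interpret Gg: group_hom B G g
    using B g G.is_group by (simp add: group_hom_def group_hom_axioms_def)
  define S where "S = f ` carrier A \<union> g ` carrier B"
  define H where "H = generate G S"
  define ev where "ev w = foldr (\<lambda>x u. case_sum f g x \<otimes>\<^bsub>G\<^esub> u) w \<one>\<^bsub>G\<^esub>" for w
  define W where "W = lists (carrier A <+> carrier B)"
  have SG: "S \<subseteq> carrier G" by (auto simp: S_def)
  have H: "subgroup H G" unfolding H_def by (rule G.generate_is_subgroup[OF SG])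
  have HG: "H \<subseteq> carrier G" using H by (rule subgroup.subset)
  have ev_closed: "ev w \<in> carrier G" if "w \<in> W" for w
    using that unfolding W_def by (induction w) (auto simp: ev_def)
  have ev_app: "ev (u @ v) = ev u \<otimes>\<^bsub>G\<^esub> ev v" if "u \<in> W" "v \<in> W" for u v
    using that(1)
  proof (induction u)
    case Nil
    then show ?case using ev_closed[OF that(2)] by (simp add: ev_def)
  next
    case (Cons x u)
    then have u: "u \<in> W" and x: "case_sum f g x \<in> carrier G" by (auto simp: W_def)
    have "ev ((x # u) @ v) = case_sum f g x \<otimes>\<^bsub>G\<^esub> ev (u @ v)" by (simp add: ev_def)
    also have "\<dots> = (case_sum f g x \<otimes>\<^bsub>G\<^esub> ev u) \<otimes>\<^bsub>G\<^esub> ev v"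
      using Cons.IH[OF u] x ev_closed[OF u] ev_closed[OF that(2)] by (simp add: G.m_assoc)
    finally show ?case by (simp add: ev_def)
  qed
  have gen: "f a \<in> ev ` W" if "a \<in> carrier A" for a
    using that by (intro image_eqI[of _ _ "[Inl a]"]) (auto simp: ev_def W_def)
  have gen': "g b \<in> ev ` W" if "b \<in> carrier B" for b
    using that by (intro image_eqI[of _ _ "[Inr b]"]) (auto simp: ev_def W_def)
  have onto: "h \<in> ev ` W" if "h \<in> H" for h
    using that unfolding H_def
  proof (induction rule: generate.induct)
    case one
    show ?case by (intro image_eqI[of _ _ "[]"]) (auto simp: ev_def W_def)
  next
    case (incl h)
    then show ?case using gen gen' by (auto simp: S_def)
  next
    case (inv h)
    then consider a where "a \<in> carrier A" "h = f a" | b where "b \<in> carrier B" "h = g b"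
      by (auto simp: S_def)
    then show ?case
    proof cases
      case 1
      then show ?thesis using gen[of "inv\<^bsub>A\<^esub> a"] by simp
    next
      case 2
      then show ?thesis using gen'[of "inv\<^bsub>B\<^esub> b"] by simp
    qed
  next
    case (eng h1 h2)
    then obtain u v where "u \<in> W" "v \<in> W" "h1 = ev u" "h2 = ev v" by blast
    then show ?case by (intro image_eqI[of _ _ "u @ v"]) (auto simp: ev_app W_def)
  qed
  define e where "e h = (SOME w. ev w = h)" for h
  have ev_e: "ev (e h) = h" if "h \<in> H" for h
    unfolding e_def using onto[OF that] by (intro someI_ex[of "\<lambda>w. ev w = h"]) blast
  define K :: "('a + 'b) list monoid" where
    "K = \<lparr>carrier = e ` H, mult = (\<lambda>u v. e (ev u \<otimes>\<^bsub>G\<^esub> ev v)), one = e \<one>\<^bsub>G\<^esub>\<rparr>"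
  have inj: "inj_on e H" by (rule inj_on_inverseI[of _ ev]) (rule ev_e)
  have eh: "e \<in> hom (G\<lparr>carrier := H\<rparr>) K"
    by (rule homI) (simp_all add: K_def ev_e)
  have iso: "e \<in> iso (G\<lparr>carrier := H\<rparr>) K"
    using eh inj by (simp add: iso_def bij_betw_def K_def)
  have gH: "group (G\<lparr>carrier := H\<rparr>)" using H by (simp add: G.subgroup_imp_group)
  have "group (K\<lparr>one := e \<one>\<^bsub>G\<^esub>\<rparr>)"
    using group.iso_imp_img_group[OF gH iso] by (simp add: K_def)
  then have K: "group K" by (simp add: K_def)
  have nK: "nilpotent_class2 K" by (rule nilpotent_class2_iso_subgroup[OF G H K iso])
  have fH: "f a \<in> H" if "a \<in> carrier A" for a
    using that by (auto simp: H_def S_def intro: generate.incl)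
  have gH': "g b \<in> H" if "b \<in> carrier B" for b
    using that by (auto simp: H_def S_def intro: generate.incl)
  have "(\<lambda>a. e (f a)) \<in> mon A K"
  proof -
    have "f \<in> hom A (G\<lparr>carrier := H\<rparr>)" using fH f by (auto simp: hom_def)
    then have "e \<circ> f \<in> hom A K" using eh by (rule hom_compose)
    moreover have "inj_on (e \<circ> f) (carrier A)"
      using f(2) inj fH by (intro comp_inj_on) (auto intro: inj_on_subset)
    ultimately show ?thesis by (simp add: mon_def comp_def)
  qed
  moreover have "(\<lambda>b. e (g b)) \<in> mon B K"
  proof -
    have "g \<in> hom B (G\<lparr>carrier := H\<rparr>)" using gH' g by (auto simp: hom_def)
    then have "e \<circ> g \<in> hom B K" using eh by (rule hom_compose)
    moreover have "inj_on (e \<circ> g) (carrier B)"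
      using g(2) inj gH' by (intro comp_inj_on) (auto intro: inj_on_subset)
    ultimately show ?thesis by (simp add: mon_def comp_def)
  qed
  ultimately have "weak_amalgam A B D i j K (\<lambda>a. e (f a)) (\<lambda>b. e (g b))"
    using nK fg by (simp add: weak_amalgam_def)
  then show ?thesis by (auto simp: amalgam_exists_def)
qed

end

theory Submission
  imports
    "HOL-Analysis.Function_Topology"
    "HOL-Analysis.Topology_Euclidean_Space"
    "HOL-Algebra.Multiplicative_Group"
    "HOL-Algebra.Product_Groups"
    Defs
begin

text \<open>
  If an amalgam exists, then \<open>[a, z^q] = [a, z]^q = [a^q, z]\<close> in it, and \<open>z\<close> commutes with
  \<open>A\<^sub>2D\<close>.

  Conversely, let \<open>M = A/A\<^sub>2D\<close>, \<open>Z = Z(B)\<close> and \<open>E = D \<inter> Z\<close>. An amalgam amounts to a bilinear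
  choice of commutators \<open>[a, z]\<close> for \<open>a \<in> M\<close>, \<open>z \<in> Z\<close> which on \<open>M \<times> E\<close> are those of \<open>A\<close>. The
  obstruction is the kernel of \<open>M \<otimes> E \<rightarrow> M \<otimes> Z\<close>, an image of \<open>Tor(M, Z/E)\<close>, and the condition
  says that the commutator vanishes on the generators of this kernel. Tensor products are avoided
  by composing the commutator with a character \<open>\<xi>\<close> of \<open>A\<^sub>2\<close>: if \<open>M\<close> is finitely generated, it is a
  direct sum of cyclic groups, and the pairing extends to \<open>M \<times> Z\<close> one generator at a time because
  the circle is divisible; in general it extends by compactness of powers of the circle. As
  characters separate the elements of \<open>A\<^sub>2\<close>, all these pairings together take their values in a
  product of circles which contains \<open>A\<^sub>2\<close>, and they define a central extension whose quotient is
  the amalgam.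
\<close>

section \<open>Homomorphisms from products and cyclic summands\<close>

text \<open>The form of the condition comes from the generators of Tor: \<open>Tor(M, Z/E)\<close>
  is generated by triples of an element a of M, a number q and an element z of Z with a^q = 1 in M
  and z^q in E, and such a triple goes to a \<otimes> z^q in M \<otimes> E. The pairing lives on M
  rather than on A because Z commutes with D and with \<open>A\<^sub>2\<close> in any amalgam. The
  circle enters because \<open>A\<^sub>2\<close> need not be divisible, so an extension with values
  in \<open>A\<^sub>2\<close> itself cannot be expected; enlarging it is harmless, as an amalgam may
  contain further central elements. In a direct sum of cyclic groups the values on the generators
  can be chosen independently, each restricted only by the order of its own generator. An arbitrary
  abelian M has no such decomposition, and extensions found on its finitely generated subgroups need
  not fit together; compactness selects a coherent choice.\<close>

lemma hom_factor:
  assumes "group X" "group Y" "group T" and p: "p \<in> hom X Y" and h: "h \<in> hom X T"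
    and ker: "\<And>x. x \<in> carrier X \<Longrightarrow> p x = \<one>\<^bsub>Y\<^esub> \<Longrightarrow> h x = \<one>\<^bsub>T\<^esub>"
  obtains h' where "h' \<in> hom (Y\<lparr>carrier := p ` carrier X\<rparr>) T"
    and "\<And>x. x \<in> carrier X \<Longrightarrow> h' (p x) = h x"
proof -
  interpret P: group_hom X Y p
    using assms by (simp add: group_hom_def group_hom_axioms_def)
  interpret H: group_hom X T h
    using assms by (simp add: group_hom_def group_hom_axioms_def)
  have eq: "h x = h y" if "x \<in> carrier X" "y \<in> carrier X" "p x = p y" for x y
  proof -
    have "h (x \<otimes>\<^bsub>X\<^esub> inv\<^bsub>X\<^esub> y) = \<one>\<^bsub>T\<^esub>"
      using that by (intro ker) auto
    then have "h x \<otimes>\<^bsub>T\<^esub> inv\<^bsub>T\<^esub> h y = \<one>\<^bsub>T\<^esub>" using that by simp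
    then show ?thesis
      using H.H.inv_equality[of "h x" "inv\<^bsub>T\<^esub> h y"] that by simp
  qed
  define h' where "h' y = h (inv_into (carrier X) p y)" for y
  have h': "h' (p x) = h x" if "x \<in> carrier X" for x
    unfolding h'_def using that
    by (intro eq) (auto intro: inv_into_into f_inv_into_f)
  moreover have "h' \<in> hom (Y\<lparr>carrier := p ` carrier X\<rparr>) T"
  proof (rule homI)
    fix u v
    assume "u \<in> carrier (Y\<lparr>carrier := p ` carrier X\<rparr>)" "v \<in> carrier (Y\<lparr>carrier := p ` carrier X\<rparr>)"
    then obtain x y where xy: "x \<in> carrier X" "y \<in> carrier X" "u = p x" "v = p y" by auto
    then have "h' (p (x \<otimes>\<^bsub>X\<^esub> y)) = h' (p x) \<otimes>\<^bsub>T\<^esub> h' (p y)"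
      by (subst h') (simp_all add: h')
    then show "h' (u \<otimes>\<^bsub>Y\<lparr>carrier := p ` carrier X\<rparr>\<^esub> v) = h' u \<otimes>\<^bsub>T\<^esub> h' v"
      using xy by simp
  qed (auto simp: h')
  ultimately show ?thesis using that by blast
qed

text \<open>Every relation between y and N has the form y^l \<in> N, so compatibility with these
  powers is all that a value t for y must satisfy. The target is an arbitrary abelian group because
  it is the circle for characters and a character group for pairings.\<close>

lemma (in comm_group) hom_extend_one:
  fixes T (structure)
  assumes N: "subgroup N G" and T: "comm_group T" and \<phi>: "\<phi> \<in> hom (G\<lparr>carrier := N\<rparr>) T"
    and y: "y \<in> carrier G" and t: "t \<in> carrier T"
    and rel: "\<And>l::int. y [^]\<^bsub>G\<^esub> l \<in> N \<Longrightarrow> \<phi> (y [^]\<^bsub>G\<^esub> l) = t [^]\<^bsub>T\<^esub> l"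
  defines "N' \<equiv> (\<lambda>(n, l::int). n \<otimes>\<^bsub>G\<^esub> y [^]\<^bsub>G\<^esub> l) ` (N \<times> UNIV)"
  obtains \<phi>' where "subgroup N' G" "\<phi>' \<in> hom (G\<lparr>carrier := N'\<rparr>) T"
    and "\<And>n (l::int). n \<in> N \<Longrightarrow> \<phi>' (n \<otimes>\<^bsub>G\<^esub> y [^]\<^bsub>G\<^esub> l) = \<phi> n \<otimes>\<^bsub>T\<^esub> t [^]\<^bsub>T\<^esub> l"
proof -
  interpret T: comm_group T by fact
  interpret N: group "G\<lparr>carrier := N\<rparr>" using N by (simp add: subgroup_imp_group)
  interpret N: group_hom "G\<lparr>carrier := N\<rparr>" T \<phi>
    using \<phi> by (simp add: group_hom_def group_hom_axioms_def N.is_group T.is_group)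
  have NG: "n \<in> carrier G" if "n \<in> N" for n using that N subgroup.subset by blast
  have \<phi>c: "\<phi> n \<in> carrier T" if "n \<in> N" for n using that N.hom_closed by simp
  \<comment> \<open>An element of \<open>N'\<close> may be n y^l in several ways. The map is
    therefore defined on pairs (n, l), where there is no ambiguity, and pushed forward along
    multiplication; \<open>rel\<close> makes it trivial on the kernel.\<close>
  let ?X = "(G\<lparr>carrier := N\<rparr>) \<times>\<times> integer_group"
  let ?p = "\<lambda>(n, l::int). n \<otimes>\<^bsub>G\<^esub> y [^]\<^bsub>G\<^esub> l" and ?h = "\<lambda>(n, l::int). \<phi> n \<otimes>\<^bsub>T\<^esub> t [^]\<^bsub>T\<^esub> l"
  have X: "group ?X" by (intro DirProd_group N.is_group group_integer_group)
  have p: "?p \<in> hom ?X G"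
    by (rule homI) (use y in \<open>auto simp: NG int_pow_mult m_ac\<close>)
  have "\<phi> (n \<otimes>\<^bsub>G\<^esub> n') = \<phi> n \<otimes>\<^bsub>T\<^esub> \<phi> n'" if "n \<in> N" "n' \<in> N" for n n'
    using hom_mult[OF \<phi>, of n n'] that by simp
  then have h: "?h \<in> hom ?X T"
    by (intro homI) (use t in \<open>auto simp: \<phi>c T.int_pow_mult T.m_ac\<close>)
  have ker: "?h x = \<one>\<^bsub>T\<^esub>" if x: "x \<in> carrier ?X" and "?p x = \<one>\<^bsub>G\<^esub>" for x
  proof -
    obtain n l where x: "x = (n, l)" "n \<in> N" using x by auto
    then have "n \<otimes>\<^bsub>G\<^esub> y [^]\<^bsub>G\<^esub> l = \<one>\<^bsub>G\<^esub>" using that by simp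
    then have n: "n = inv\<^bsub>G\<^esub> (y [^]\<^bsub>G\<^esub> l)" using inv_equality x y NG by force
    then have "n = y [^]\<^bsub>G\<^esub> (-l)" using y by (simp add: int_pow_neg)
    then have "\<phi> n = t [^]\<^bsub>T\<^esub> (-l)" using rel x by simp
    then show ?thesis using x t T.int_pow_mult[of t "-l" l] by simp
  qed
  obtain \<phi>' where \<phi>': "\<phi>' \<in> hom (G\<lparr>carrier := ?p ` carrier ?X\<rparr>) T"
      "\<And>x. x \<in> carrier ?X \<Longrightarrow> \<phi>' (?p x) = ?h x"
    using hom_factor[OF X is_group T.is_group p h ker] by metis
  have N': "?p ` carrier ?X = N'" by (simp add: N'_def)
  have "subgroup (?p ` carrier ?X) G"
    using X p is_group group_hom.img_is_subgroup[of ?X G ?p]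
    by (simp add: group_hom_def group_hom_axioms_def)
  moreover have "\<phi>' (n \<otimes>\<^bsub>G\<^esub> y [^]\<^bsub>G\<^esub> l) = \<phi> n \<otimes>\<^bsub>T\<^esub> t [^]\<^bsub>T\<^esub> l" if "n \<in> N" for n and l :: int
    using \<phi>'(2)[of "(n, l)"] that by simp
  ultimately show ?thesis using that \<phi>'(1) N' by metis
qed

section \<open>Finitely generated abelian groups and their cyclic summands\<close>

definition (in comm_group) lincomb :: "'i set \<Rightarrow> ('i \<Rightarrow> 'a) \<Rightarrow> ('i \<Rightarrow> int) \<Rightarrow> 'a" where
  "lincomb I x c = (\<Otimes>i\<in>I. x i [^] c i)"

context comm_group
begin

lemma lincomb_closed [simp]: "x \<in> I \<rightarrow> carrier G \<Longrightarrow> lincomb I x c \<in> carrier G"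
  unfolding lincomb_def by (intro finprod_closed) auto

lemma lincomb_cong: "x \<in> I \<rightarrow> carrier G \<Longrightarrow> (\<And>i. i \<in> I \<Longrightarrow> x i = y i) \<Longrightarrow> (\<And>i. i \<in> I \<Longrightarrow> c i = d i) \<Longrightarrow>
    lincomb I x c = lincomb I y d"
  unfolding lincomb_def by (intro finprod_cong) (auto simp: simp_implies_def)

lemma lincomb_add:
  "x \<in> I \<rightarrow> carrier G \<Longrightarrow> lincomb I x (\<lambda>i. c i + d i) = lincomb I x c \<otimes> lincomb I x d"
proof -
  assume x: "x \<in> I \<rightarrow> carrier G"
  then have "lincomb I x (\<lambda>i. c i + d i) = (\<Otimes>i\<in>I. x i [^] c i \<otimes> x i [^] d i)"
    unfolding lincomb_def by (intro finprod_cong') (auto simp: int_pow_mult Pi_iff)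
  also have "\<dots> = lincomb I x c \<otimes> lincomb I x d"
    unfolding lincomb_def using x by (intro finprod_multf) auto
  finally show ?thesis .
qed

lemma lincomb_scale:
  assumes "finite I" "x \<in> I \<rightarrow> carrier G"
  shows "lincomb I x (\<lambda>i. c i * l) = lincomb I x c [^] (l::int)"
  using assms
  by (induction I) (auto simp: lincomb_def int_pow_pow int_pow_distrib Pi_def)

lemma lincomb_remove:
  assumes "finite I" "k \<in> I" "x \<in> I \<rightarrow> carrier G"
  shows "lincomb I x c = x k [^] c k \<otimes> lincomb (I - {k}) x c"
proof -
  have "lincomb (insert k (I - {k})) x c = x k [^] c k \<otimes> lincomb (I - {k}) x c"
    unfolding lincomb_def using assms by (intro finprod_insert) auto
  then show ?thesis using assms by (simp add: insert_absorb)
qed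

lemma range_lincomb_subgroup:
  assumes "finite I" "x \<in> I \<rightarrow> carrier G"
  shows "subgroup (range (lincomb I x)) G"
proof (rule subgroupI)
  fix a assume "a \<in> range (lincomb I x)"
  then obtain c where "a = lincomb I x c" by auto
  then have "inv a = lincomb I x (\<lambda>i. c i * (-1))"
    using assms lincomb_scale[OF assms, of c "-1"] by (simp add: int_pow_neg)
  then show "inv a \<in> range (lincomb I x)" by blast
next
  fix a b assume "a \<in> range (lincomb I x)" "b \<in> range (lincomb I x)"
  then obtain c d where "a = lincomb I x c" "b = lincomb I x d" by auto
  then have "a \<otimes> b = lincomb I x (\<lambda>i. c i + d i)" using assms by (simp add: lincomb_add)
  then show "a \<otimes> b \<in> range (lincomb I x)" by blast
qed (use assms in auto)

lemma generator_in_range_lincomb: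
  assumes "finite I" "k \<in> I" "x \<in> I \<rightarrow> carrier G"
  shows "x k \<in> range (lincomb I x)"
proof -
  have "lincomb I x (\<lambda>i. if i = k then 1 else 0) =
      x k [^] (1::int) \<otimes> lincomb (I - {k}) x (\<lambda>i. if i = k then 1 else 0)"
    using assms by (simp add: lincomb_remove)
  also have "lincomb (I - {k}) x (\<lambda>i. if i = k then 1 else 0) = lincomb (I - {k}) x (\<lambda>i. 0)"
    using assms by (intro lincomb_cong) auto
  also have "\<dots> = \<one>" unfolding lincomb_def by simp
  finally show ?thesis using assms by (metis PiE Pi_mem int_pow_1 r_one rangeI)
qed

text \<open>This is the shape of the domain in \<open>hom_extend_one\<close>: one generator is
  adjoined to the subgroup of the others.\<close>

lemma range_lincomb_remove:
  assumes "finite I" "k \<in> I" "x \<in> I \<rightarrow> carrier G"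
  shows "range (lincomb I x) = (\<lambda>(n, l::int). n \<otimes> x k [^] l) ` (range (lincomb (I - {k}) x) \<times> UNIV)"
    (is "?L = ?R")
proof (intro equalityI subsetI)
  fix a assume "a \<in> ?L"
  then obtain c where "a = lincomb I x c" by auto
  then have "a = lincomb (I - {k}) x c \<otimes> x k [^] c k"
    using assms by (subst m_comm) (auto simp: lincomb_remove intro!: lincomb_closed)
  then show "a \<in> ?R" by force
next
  fix a assume "a \<in> ?R"
  then obtain n l where "n \<in> range (lincomb (I - {k}) x)" "a = n \<otimes> x k [^] (l::int)" by auto
  then obtain c where a: "a = lincomb (I - {k}) x c \<otimes> x k [^] l" by blast
  have "lincomb I x (c(k := l)) = x k [^] l \<otimes> lincomb (I - {k}) x (c(k := l))"
    using assms by (simp add: lincomb_remove)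
  also have "lincomb (I - {k}) x (c(k := l)) = lincomb (I - {k}) x c"
    using assms by (intro lincomb_cong) auto
  also have "x k [^] l \<otimes> \<dots> = a"
    unfolding a using assms by (intro m_comm lincomb_closed) auto
  finally show "a \<in> ?L" by (metis rangeI)
qed

text \<open>The cyclic summand comes from a relation with the smallest positive coefficient \<open>m\<close>
  among all generating tuples: dividing the other coefficients by \<open>m\<close> with remainder yields a
  relation whose coefficients are those remainders, which therefore vanish.\<close>

lemma cyclic_summand:
  assumes I: "finite I" "I \<noteq> {}" and x: "x \<in> I \<rightarrow> carrier G"
  obtains k x' where "k \<in> I" "x' \<in> I \<rightarrow> carrier G" "range (lincomb I x') = range (lincomb I x)"
    and "\<And>l::int. x' k [^] l \<in> range (lincomb (I - {k}) x') \<Longrightarrow> x' k [^] l = \<one>"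
proof -
  \<comment> \<open>The tuple varies along with the relation while the index set stays fixed: the
    exchange of generators below changes a single entry, so its result competes for the same
    minimum.\<close>
  define Q where "Q m \<longleftrightarrow> m > 0 \<and> (\<exists>x' c. \<exists>k\<in>I. x' \<in> I \<rightarrow> carrier G \<and>
      range (lincomb I x') = range (lincomb I x) \<and> lincomb I x' c = \<one> \<and> c k = int m)" for m
  have relation: "lincomb I x' (\<lambda>i. if i = k then l else - d i) = \<one>"
    if "x' \<in> I \<rightarrow> carrier G" "k \<in> I" "x' k [^] l = lincomb (I - {k}) x' d" for x' k d l
  proof -
    have "lincomb I x' (\<lambda>i. if i = k then l else - d i) =
        x' k [^] l \<otimes> lincomb (I - {k}) x' (\<lambda>i. if i = k then l else - d i)"
      using that I by (simp add: lincomb_remove)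
    also have "\<dots> = lincomb (I - {k}) x' d \<otimes> lincomb (I - {k}) x' (\<lambda>i. - d i)"
      using that by (simp, intro arg_cong2[of _ _ _ _ "(\<otimes>)"] lincomb_cong) auto
    also have "\<dots> = lincomb (I - {k}) x' (\<lambda>i. d i + - d i)"
      using that by (subst lincomb_add) auto
    also have "\<dots> = \<one>" by (simp add: lincomb_def)
    finally show ?thesis .
  qed
  show ?thesis
  proof (cases "\<exists>m. Q m")
    \<comment> \<open>No tuple has a relation with a positive coefficient and, inverting relations,
      none with a negative one. The generators are independent, so any k serves and l must be
      0.\<close>
    case False
    obtain k where k: "k \<in> I" using I by auto
    have "x k [^] l = \<one>" if l: "x k [^] l \<in> range (lincomb (I - {k}) x)" for l :: int
    proof -
      obtain d where "x k [^] l = lincomb (I - {k}) x d" using l by blast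
      define e where "e = (\<lambda>i. if i = k then l else - d i)"
      have e: "lincomb I x e = \<one>"
        unfolding e_def by (rule relation) fact+
      then have e': "lincomb I x (\<lambda>i. e i * (-1)) = \<one>"
        using lincomb_scale[OF I(1) x, of e "-1"] by simp
      have "l = 0"
      proof (rule ccontr)
        assume "l \<noteq> 0"
        then consider "l > 0" | "l < 0" by linarith
        then have "Q (nat \<bar>l\<bar>)"
        proof cases
          case 1
          then show ?thesis unfolding Q_def using e k x
            by (intro conjI exI[of _ x] exI[of _ e] bexI[of _ k]) (auto simp: e_def)
        next
          case 2
          then show ?thesis unfolding Q_def using e' k x
            by (intro conjI exI[of _ x] exI[of _ "\<lambda>i. e i * (-1)"] bexI[of _ k]) (auto simp: e_def)
        qed
        then show False using False by blast
      qed
      then show ?thesis by simp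
    qed
    then show ?thesis using that[OF k x] by simp
  next
    case True
    define m where "m = (LEAST m. Q m)"
    have "Q m" unfolding m_def using True by (rule LeastI_ex)
    then obtain x' c k where m: "m > 0" and k: "k \<in> I" and x': "x' \<in> I \<rightarrow> carrier G"
      and r: "range (lincomb I x') = range (lincomb I x)" and c: "lincomb I x' c = \<one>" "c k = int m"
      unfolding Q_def by auto
    have min: "\<not> Q m'" if "m' < m" for m' using that not_less_Least unfolding m_def by blast
    define J where "J = I - {k}"
    have J: "finite J" "x' \<in> J \<rightarrow> carrier G" using I x' by (auto simp: J_def)
    have x'k: "x' k \<in> carrier G" using x' k by auto
    \<comment> \<open>Write c i = m q_i + r_i. As c k = m, the relation c turns into y^m times the
      product of the powers of x' i with exponents r_i, once the quotients are absorbed into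
      y.\<close>
    define y where "y = x' k \<otimes> lincomb J x' (\<lambda>i. c i div int m)"
    have y: "y \<in> carrier G" using J x'k by (simp add: y_def)
    define z where "z = x'(k := y)"
    have z: "z \<in> I \<rightarrow> carrier G" using x' y by (auto simp: z_def)
    have zJ: "lincomb J z d = lincomb J x' d" for d
      using J by (intro lincomb_cong) (auto simp: z_def J_def)
    have ypow: "lincomb J x' d \<otimes> y [^] l = lincomb J x' (\<lambda>i. d i + c i div int m * l) \<otimes> x' k [^] l" for d l
      using J x'k by (simp add: y_def int_pow_distrib lincomb_add lincomb_scale m_ac)
    have range_z: "range (lincomb I z) = range (lincomb I x)"
    proof -
      have "(\<lambda>(n, l::int). n \<otimes> y [^] l) ` (range (lincomb J x') \<times> UNIV)
          = (\<lambda>(n, l::int). n \<otimes> x' k [^] l) ` (range (lincomb J x') \<times> UNIV)" (is "?L = ?R")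
      proof (intro equalityI subsetI)
        fix a assume "a \<in> ?L"
        then obtain d l where "a = lincomb J x' d \<otimes> y [^] (l::int)" by auto
        then have "a = lincomb J x' (\<lambda>i. d i + c i div int m * l) \<otimes> x' k [^] l" by (simp add: ypow)
        then show "a \<in> ?R" by force
      next
        fix a assume "a \<in> ?R"
        then obtain d l where a: "a = lincomb J x' d \<otimes> x' k [^] (l::int)" by auto
        have "a = lincomb J x' (\<lambda>i. d i - c i div int m * l) \<otimes> y [^] l"
          unfolding ypow by (simp add: a)
        then show "a \<in> ?L" by force
      qed
      then have "range (lincomb I z) = range (lincomb I x')"
        using range_lincomb_remove[OF I(1) k x'] range_lincomb_remove[OF I(1) k z]
        by (simp add: z_def[THEN fun_cong, of k] zJ[abs_def] flip: J_def)
      then show ?thesis using r by simp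
    qed
    \<comment> \<open>\<open>z\<close> generates the same subgroup as \<open>x\<close>, so the
      minimality of m governs its relations at every index, not only at k.\<close>
    have coeff_zero: "d i = 0" if "lincomb I z d = \<one>" "i \<in> I" "0 \<le> d i" "d i < int m" for d i
    proof (rule ccontr)
      assume "d i \<noteq> 0"
      then have "Q (nat (d i))" unfolding Q_def using that z range_z
        by (intro conjI exI[of _ z] exI[of _ d] bexI[of _ i]) auto
      then show False using min[of "nat (d i)"] that by simp
    qed
    have ym: "y [^] int m = \<one>"
    proof -
      define e where "e i = (if i = k then int m else c i mod int m)" for i
      have eJ: "lincomb J x' e = lincomb J x' (\<lambda>i. c i mod int m)"
        using J by (intro lincomb_cong) (auto simp: e_def J_def)
      have "lincomb I z e = lincomb J x' (\<lambda>i. c i mod int m) \<otimes> y [^] int m"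
        using lincomb_remove[OF I(1) k z, of e] y J
        by (simp add: z_def[THEN fun_cong, of k] zJ eJ e_def[of k] m_comm flip: J_def)
      also have "\<dots> = lincomb J x' c \<otimes> x' k [^] int m"
        by (simp add: ypow)
      also have "\<dots> = lincomb I x' c"
        using lincomb_remove[OF I(1) k x', of c] J x'k c(2) by (simp add: m_comm flip: J_def)
      finally have e: "lincomb I z e = \<one>" using c by simp
      have "c i mod int m = 0" if "i \<in> J" for i
        using coeff_zero[OF e, of i] that m by (auto simp: e_def J_def)
      then have "lincomb J x' (\<lambda>i. c i mod int m) = lincomb J x' (\<lambda>i. 0)"
        using J by (intro lincomb_cong) auto
      then have "lincomb J x' (\<lambda>i. c i mod int m) = \<one>" by (simp add: lincomb_def)
      then show ?thesis
        using e y \<open>lincomb I z e = lincomb J x' (\<lambda>i. c i mod int m) \<otimes> y [^] int m\<close> by simp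
    qed
    have "z k [^] l = \<one>" if l: "z k [^] l \<in> range (lincomb (I - {k}) z)" for l :: int
    proof -
      have zk: "z k = y" by (simp add: z_def)
      \<comment> \<open>As y^m = 1, only l mod m matters, and it is a coefficient below m in a
        relation of \<open>z\<close>.\<close>
      have "z k [^] l = (y [^] int m) [^] (l div int m) \<otimes> y [^] (l mod int m)"
        using y by (simp add: zk int_pow_pow flip: int_pow_mult)
      then have lm: "z k [^] l = z k [^] (l mod int m)" using ym y zk by simp
      then obtain d where "z k [^] (l mod int m) = lincomb (I - {k}) z d" using l by auto
      then have "lincomb I z (\<lambda>i. if i = k then l mod int m else - d i) = \<one>"
        using relation[OF z k] by blast
      then have "l mod int m = 0" using coeff_zero[of _ k] k m by fastforce
      then show ?thesis using lm by simp
    qed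
    then show ?thesis using that[OF k z range_z] by blast
  qed
qed

end

section \<open>Characters and extension of pairings\<close>

text \<open>Tychonoff's theorem: the set is a power of the circle, and the topology of the function
  type is the product topology.\<close>

lemma compact_circle_functions: "compact {f :: 'x \<Rightarrow> complex. \<forall>x. norm (f x) = 1}"
proof -
  have "compactin (product_topology (\<lambda>x::'x. euclidean) UNIV) (PiE UNIV (\<lambda>x. sphere (0::complex) 1))"
    unfolding compactin_PiE by (simp add: compactin_euclidean_iff)
  moreover have "PiE UNIV (\<lambda>x. sphere (0::complex) 1) = {f :: 'x \<Rightarrow> complex. \<forall>x. norm (f x) = 1}"
    by (auto simp: PiE_def)
  ultimately show ?thesis by (simp add: euclidean_product_topology compactin_euclidean_iff)
qed

text \<open>Finite intersection property: finitely many sets C S have a common member on the circle,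
  namely a solution for the union of the sets S. Solutions for different S need not extend one
  another, so they cannot simply be glued.\<close>

lemma circle_function_compactness:
  fixes C :: "'i set \<Rightarrow> ('x \<Rightarrow> complex) set"
  assumes closed: "\<And>S. finite S \<Longrightarrow> S \<subseteq> I \<Longrightarrow> closed (C S)"
    and nonempty: "\<And>S. finite S \<Longrightarrow> S \<subseteq> I \<Longrightarrow> \<exists>f\<in>C S. \<forall>x. norm (f x) = 1"
    and anti: "\<And>S S'. S \<subseteq> S' \<Longrightarrow> C S' \<subseteq> C S"
  obtains f where "\<And>x. norm (f x) = 1" and "\<And>S. finite S \<Longrightarrow> S \<subseteq> I \<Longrightarrow> f \<in> C S"
proof -
  let ?F = "{S. finite S \<and> S \<subseteq> I}" and ?P = "{f :: 'x \<Rightarrow> complex. \<forall>x. norm (f x) = 1}"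
  have "?P \<inter> (\<Inter>S\<in>?F. C S) \<noteq> {}"
  proof (rule compact_imp_fip_image[OF compact_circle_functions])
    fix \<F> assume \<F>: "finite \<F>" "\<F> \<subseteq> ?F"
    then have "finite (\<Union>\<F>)" "\<Union>\<F> \<subseteq> I" by auto
    then obtain f where f: "f \<in> C (\<Union>\<F>)" "\<forall>x. norm (f x) = 1" using nonempty by blast
    have "f \<in> C S" if "S \<in> \<F>" for S using anti[of S "\<Union>\<F>"] f that by blast
    then show "?P \<inter> (\<Inter>S\<in>\<F>. C S) \<noteq> {}" using f by blast
  qed (use closed in auto)
  then show ?thesis using that by blast
qed

section \<open>The circle as a divisible group, and characters of abelian groups\<close>

definition circle :: "complex monoid" where
  "circle = \<lparr>carrier = sphere 0 1, mult = (*), one = 1\<rparr>"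

lemma circle_simps [simp]:
  "t \<in> carrier circle \<longleftrightarrow> norm t = 1" "s \<otimes>\<^bsub>circle\<^esub> t = s * t" "\<one>\<^bsub>circle\<^esub> = 1"
  by (simp_all add: circle_def)

lemma comm_group_circle: "comm_group circle"
proof (rule comm_groupI)
  fix t assume "t \<in> carrier circle"
  then have "norm t = 1" "t \<noteq> 0" by auto
  then show "\<exists>s\<in>carrier circle. s \<otimes>\<^bsub>circle\<^esub> t = \<one>\<^bsub>circle\<^esub>"
    by (intro bexI[of _ "inverse t"]) (auto simp: norm_inverse)
qed (auto simp: norm_mult)

interpretation circle: comm_group circle by (rule comm_group_circle)

lemma circle_nat_pow [simp]: "t [^]\<^bsub>circle\<^esub> (n::nat) = t ^ n"
  by (induction n) auto

lemma circle_root: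
  assumes "s \<in> carrier circle" "n > 0"
  obtains t where "t \<in> carrier circle" "t [^]\<^bsub>circle\<^esub> (n::nat) = s"
proof -
  have "s = cis (Arg s)" using assms cis_Arg[of s] by (cases "s = 0") (auto simp: sgn_div_norm)
  then have "cis (Arg s / n) ^ n = s" using assms by (simp add: DeMoivre)
  then show ?thesis using that[of "cis (Arg s / n)"] by simp
qed

lemma circle_homI:
  "(\<And>x. x \<in> carrier G \<Longrightarrow> norm (\<xi> x) = 1) \<Longrightarrow>
   (\<And>x y. x \<in> carrier G \<Longrightarrow> y \<in> carrier G \<Longrightarrow> \<xi> (x \<otimes>\<^bsub>G\<^esub> y) = \<xi> x * \<xi> y) \<Longrightarrow> \<xi> \<in> hom G circle"
  by (rule homI) auto

lemma circle_hom_norm: "\<xi> \<in> hom G circle \<Longrightarrow> x \<in> carrier G \<Longrightarrow> norm (\<xi> x) = 1"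
  using hom_in_carrier by fastforce

lemma circle_hom_mult:
  "\<xi> \<in> hom G circle \<Longrightarrow> x \<in> carrier G \<Longrightarrow> y \<in> carrier G \<Longrightarrow> \<xi> (x \<otimes>\<^bsub>G\<^esub> y) = \<xi> x * \<xi> y"
  using hom_mult by fastforce

lemma (in group) circle_hom_one: "\<xi> \<in> hom G circle \<Longrightarrow> \<xi> \<one> = 1"
  using hom_one[of \<xi> G circle] is_group circle.is_group by simp

context comm_group
begin

text \<open>k is the order of x modulo H. Infinite order gives 0, which divides only 0, so the
  formula covers that case too.\<close>

lemma subgroup_int_pow_iff:
  assumes H: "subgroup H G" and x: "x \<in> carrier G"
  obtains k :: nat where "\<And>l::int. x [^] l \<in> H \<longleftrightarrow> int k dvd l"
proof -
  interpret normal H G using H by (simp add: normal_iff_subgroup)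
  interpret Q: group "G Mod H" by (rule factorgroup_is_group)
  have c: "H #> x \<in> carrier (G Mod H)" using x by (auto simp: carrier_FactGroup)
  have "x [^] l \<in> H \<longleftrightarrow> int (group.ord (G Mod H) (H #> x)) dvd l" for l :: int
  proof -
    have "x [^] l \<in> H \<longleftrightarrow> H #> x [^] l = H"
      using x H by (metis coset_join1 coset_join2 int_pow_closed subset is_subgroup)
    also have "\<dots> \<longleftrightarrow> (H #> x) [^]\<^bsub>G Mod H\<^esub> l = \<one>\<^bsub>G Mod H\<^esub>"
      using x by (simp add: FactGroup_int_pow)
    finally show ?thesis using Q.int_pow_eq_id[OF c] by simp
  qed
  then show ?thesis using that by blast
qed

text \<open>Let k be the order of x modulo the subgroup reached so far. By divisibility the circle
  contains a k-th root t of the value at x^k, and all powers of x in that subgroup are powers of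
  x^k, so t is compatible with them.\<close>

lemma circle_hom_extend_finite:
  assumes "finite S" "S \<subseteq> carrier G" "subgroup H G" "\<xi> \<in> hom (G\<lparr>carrier := H\<rparr>) circle"
  shows "\<exists>H' \<xi>'. subgroup H' G \<and> H \<union> S \<subseteq> H' \<and> \<xi>' \<in> hom (G\<lparr>carrier := H'\<rparr>) circle \<and> (\<forall>h\<in>H. \<xi>' h = \<xi> h)"
  using assms
proof (induction S rule: finite_induct)
  case empty
  then show ?case by auto
next
  case (insert x S)
  then obtain N \<phi> where N: "subgroup N G" "H \<union> S \<subseteq> N"
    and \<phi>: "\<phi> \<in> hom (G\<lparr>carrier := N\<rparr>) circle" "\<forall>h\<in>H. \<phi> h = \<xi> h" by auto
  interpret N: group "G\<lparr>carrier := N\<rparr>" using N by (simp add: subgroup_imp_group)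
  interpret \<phi>: group_hom "G\<lparr>carrier := N\<rparr>" circle \<phi>
    using \<phi> by (simp add: group_hom_def group_hom_axioms_def N.is_group circle.is_group)
  have x: "x \<in> carrier G" using insert.prems by simp
  obtain k where k: "\<And>l::int. x [^] l \<in> N \<longleftrightarrow> int k dvd l"
    using subgroup_int_pow_iff[OF N(1) x] by blast
  have xk: "x [^] int k \<in> N" using k by simp
  \<comment> \<open>For k = 0 the element x is independent of N: the equation for t reads 1 = 1, and
    t = 1 is as good as any value.\<close>
  have "\<exists>t\<in>carrier circle. t [^]\<^bsub>circle\<^esub> int k = \<phi> (x [^] int k)"
  proof (cases "k = 0")
    case True
    then show ?thesis using \<phi>.hom_one by (intro bexI[of _ 1]) auto
  next
    case False
    have "\<phi> (x [^] int k) \<in> carrier circle" by (rule \<phi>.hom_closed) (use xk in simp)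
    then obtain t where "t \<in> carrier circle" "t [^]\<^bsub>circle\<^esub> k = \<phi> (x [^] int k)"
      using False circle_root by (metis gr0I)
    then show ?thesis unfolding int_pow_int by blast
  qed

  then obtain t where t: "t \<in> carrier circle" "t [^]\<^bsub>circle\<^esub> int k = \<phi> (x [^] int k)" by blast
  have rel: "\<phi> (x [^] l) = t [^]\<^bsub>circle\<^esub> l" if xl: "x [^] l \<in> N" for l :: int
  proof -
    obtain j where j: "l = int k * j" using k xl by auto
    have "x [^] l = (x [^] int k) [^] j" using x by (simp only: j int_pow_pow)
    also have "\<dots> = (x [^] int k) [^]\<^bsub>G\<lparr>carrier := N\<rparr>\<^esub> j"
      by (rule int_pow_consistent[OF N(1) xk])
    finally have "\<phi> (x [^] l) = \<phi> ((x [^] int k) [^]\<^bsub>G\<lparr>carrier := N\<rparr>\<^esub> j)" by (rule arg_cong)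
    also have "\<dots> = \<phi> (x [^] int k) [^]\<^bsub>circle\<^esub> j"
      using xk by (intro \<phi>.hom_int_pow) simp
    also have "\<dots> = t [^]\<^bsub>circle\<^esub> l" unfolding t(2)[symmetric] j by (rule circle.int_pow_pow[OF t(1)])
    finally show ?thesis .
  qed
  define N' where "N' = (\<lambda>(n, l::int). n \<otimes> x [^] l) ` (N \<times> UNIV)"
  obtain \<phi>' where N': "subgroup N' G" and \<phi>': "\<phi>' \<in> hom (G\<lparr>carrier := N'\<rparr>) circle"
    and ext: "\<And>n (l::int). n \<in> N \<Longrightarrow> \<phi>' (n \<otimes> x [^] l) = \<phi> n \<otimes>\<^bsub>circle\<^esub> t [^]\<^bsub>circle\<^esub> l"
    using hom_extend_one[OF N(1) comm_group_circle \<phi>(1) x t(1) rel] unfolding N'_def by blast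
  have NG: "n \<in> carrier G" if "n \<in> N" for n using that N subgroup.subset by blast
  have "n \<in> N'" if "n \<in> N" for n
    unfolding N'_def using NG[OF that] that by (intro image_eqI[of _ _ "(n, 0)"]) auto
  moreover have "x \<in> N'"
    unfolding N'_def using x N(1) by (intro image_eqI[of _ _ "(\<one>, 1)"]) (auto simp: subgroup.one_closed)
  moreover have "\<phi>' n = \<phi> n" if "n \<in> N" for n
    using ext[OF that, of 0] NG[OF that] by simp
  ultimately show ?case using N' \<phi>' N(2) \<phi>(2) by (intro exI[of _ N'] exI[of _ \<phi>']) auto
qed

lemma circle_hom_extend:
  assumes H: "subgroup H G" and \<xi>: "\<xi> \<in> hom (G\<lparr>carrier := H\<rparr>) circle"
  obtains \<xi>' where "\<xi>' \<in> hom G circle" "\<And>h. h \<in> H \<Longrightarrow> \<xi>' h = \<xi> h"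
proof -
  \<comment> \<open>Each condition equates continuous functions of finitely many coordinates, hence
    is closed. Multiplicativity on pairs from S is enough, because any two elements of G lie in a
    common finite S.\<close>
  define C where "C S = {f :: 'a \<Rightarrow> complex.
    (\<forall>x\<in>S. \<forall>y\<in>S. f (x \<otimes> y) = f x * f y) \<and> (\<forall>h\<in>H \<inter> S. f h = \<xi> h)}" for S
  obtain f where f: "\<And>x. norm (f x) = 1" "\<And>S. finite S \<Longrightarrow> S \<subseteq> carrier G \<Longrightarrow> f \<in> C S"
  proof (rule circle_function_compactness[of "carrier G" C])
    fix S show "closed (C S)"
      unfolding C_def Ball_def
      by (intro closed_Collect_conj closed_Collect_all closed_Collect_imp open_Collect_const
          closed_Collect_eq continuous_intros continuous_on_product_coordinates)
  next
    fix S assume S: "finite S" "S \<subseteq> carrier G"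
    obtain H' \<xi>' where H': "subgroup H' G" "H \<union> S \<subseteq> H'"
      and \<xi>': "\<xi>' \<in> hom (G\<lparr>carrier := H'\<rparr>) circle" "\<forall>h\<in>H. \<xi>' h = \<xi> h"
      using circle_hom_extend_finite[OF S H \<xi>] by blast
    \<comment> \<open>The value 1 off \<open>H'\<close> keeps f inside the compact power of the
      circle, which is indexed by the whole type.\<close>
    define f where "f x = (if x \<in> H' then \<xi>' x else 1)" for x
    have "norm (f x) = 1" for x using circle_hom_norm[OF \<xi>'(1)] by (auto simp: f_def)
    moreover have "f (x \<otimes> y) = f x * f y" if "x \<in> H'" "y \<in> H'" for x y
      using that circle_hom_mult[OF \<xi>'(1)] H' by (auto simp: f_def subgroup.m_closed)
    moreover have "f h = \<xi> h" if "h \<in> H" for h using that H' \<xi>' by (auto simp: f_def)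
    ultimately show "\<exists>f\<in>C S. \<forall>x. norm (f x) = 1"
      using H'(2) by (intro bexI[of _ f]) (auto simp: C_def subset_iff)
  next
    fix S S' :: "'a set" assume "S \<subseteq> S'"
    then show "C S' \<subseteq> C S" unfolding C_def by blast
  qed blast
  have "f (x \<otimes> y) = f x * f y" if "x \<in> carrier G" "y \<in> carrier G" for x y
    using f(2)[of "{x, y}"] that by (auto simp: C_def)
  then have "f \<in> hom G circle" using f(1) by (intro circle_homI) auto
  moreover have "f h = \<xi> h" if "h \<in> H" for h
    using f(2)[of "{h}"] that subgroup.subset[OF H] by (auto simp: C_def)
  ultimately show ?thesis using that by blast
qed

text \<open>The cyclic group generated by c has a character with value t \<noteq> 1 at c as soon as
  t^(ord c) = 1, and characters of subgroups extend to G. For infinite order \<open>ord c\<close> is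
  0 and any t on the circle meets the equation, such as -1.\<close>

lemma circle_hom_separates:
  assumes c: "c \<in> carrier G" "c \<noteq> \<one>"
  obtains \<xi> where "\<xi> \<in> hom G circle" "\<xi> c \<noteq> 1"
proof -
  have "\<exists>t\<in>carrier circle. t \<noteq> 1 \<and> t [^]\<^bsub>circle\<^esub> int (ord c) = 1"
  proof (cases "ord c = 0")
    case True
    then show ?thesis by (intro bexI[of _ "-1"]) auto
  next
    case False
    have "ord c \<noteq> 1" using c ord_eq_1 by auto
    then have k: "ord c \<ge> 2" using False by linarith
    \<comment> \<open>A primitive root of unity. As \<open>ord c\<close> is at least 2, its angle is
      positive and at most pi, where cos is below cos 0.\<close>
    define t where "t = cis (2 * pi / ord c)"
    have "t ^ ord c = 1" using False by (simp add: t_def DeMoivre)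
    moreover have "t \<noteq> 1"
    proof
      assume "t = 1"
      then have "cos (2 * pi / ord c) = 1" by (simp add: t_def complex_eq_iff)
      moreover have "cos (2 * pi / ord c) < cos 0"
        using k by (intro cos_monotone_0_pi) (auto simp: field_simps)
      ultimately show False by simp
    qed
    ultimately show ?thesis unfolding int_pow_int by (intro bexI[of _ t]) (auto simp: t_def)
  qed
  then obtain t where t: "t \<in> carrier circle" "t \<noteq> 1" "t [^]\<^bsub>circle\<^esub> int (ord c) = 1" by blast
  have triv: "(\<lambda>_. 1) \<in> hom (G\<lparr>carrier := {\<one>}\<rparr>) circle" by (rule circle_homI) auto
  have rel: "1 = t [^]\<^bsub>circle\<^esub> l" if cl: "c [^] l \<in> {\<one>}" for l :: int
  proof -
    obtain j where "l = int (ord c) * j" using cl int_pow_eq_id[OF c(1)] by auto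
    then have "t [^]\<^bsub>circle\<^esub> l = (t [^]\<^bsub>circle\<^esub> int (ord c)) [^]\<^bsub>circle\<^esub> j"
      using t(1) by (simp add: circle.int_pow_pow)
    then show ?thesis using t(3) circle.int_pow_one by simp
  qed
  obtain \<phi> where \<phi>: "subgroup ((\<lambda>(n, l::int). n \<otimes> c [^] l) ` ({\<one>} \<times> UNIV)) G"
      "\<phi> \<in> hom (G\<lparr>carrier := (\<lambda>(n, l::int). n \<otimes> c [^] l) ` ({\<one>} \<times> UNIV)\<rparr>) circle"
      "\<And>n (l::int). n \<in> {\<one>} \<Longrightarrow> \<phi> (n \<otimes> c [^] l) = 1 \<otimes>\<^bsub>circle\<^esub> t [^]\<^bsub>circle\<^esub> l"
    using hom_extend_one[OF triv_subgroup comm_group_circle triv c(1) t(1) rel] by blast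
  obtain \<xi> where \<xi>: "\<xi> \<in> hom G circle"
      "\<And>h. h \<in> (\<lambda>(n, l::int). n \<otimes> c [^] l) ` ({\<one>} \<times> UNIV) \<Longrightarrow> \<xi> h = \<phi> h"
    using circle_hom_extend[OF \<phi>(1,2)] by blast
  have "\<xi> c = \<phi> c" using c by (intro \<xi>(2) image_eqI[of _ _ "(\<one>, 1)"]) auto
  also have "\<dots> = t" using \<phi>(3)[of \<one> 1] c t by simp
  finally show ?thesis using that \<xi>(1) t(2) by blast
qed

end

section \<open>Character groups, and extension of a pairing in its second argument\<close>

text \<open>Characters are normalised to be \<open>1\<close> off the carrier, so that equality is extensional.\<close>

definition char_group :: "('a, 'b) monoid_scheme \<Rightarrow> ('a \<Rightarrow> complex) monoid" where
  "char_group G = \<lparr>carrier = {\<xi> \<in> hom G circle. \<forall>x. x \<notin> carrier G \<longrightarrow> \<xi> x = 1},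
     mult = (\<lambda>\<xi> \<psi> x. \<xi> x * \<psi> x), one = (\<lambda>_. 1)\<rparr>"

lemma char_group_simps [simp]:
  "\<xi> \<in> carrier (char_group G) \<longleftrightarrow> \<xi> \<in> hom G circle \<and> (\<forall>x. x \<notin> carrier G \<longrightarrow> \<xi> x = 1)"
  "\<xi> \<otimes>\<^bsub>char_group G\<^esub> \<psi> = (\<lambda>x. \<xi> x * \<psi> x)" "\<one>\<^bsub>char_group G\<^esub> = (\<lambda>_. 1)"
  by (simp_all add: char_group_def)

lemma (in group) comm_group_char_group: "comm_group (char_group G)"
proof (rule comm_groupI)
  fix \<xi> \<psi> assume "\<xi> \<in> carrier (char_group G)" "\<psi> \<in> carrier (char_group G)"
  then show "\<xi> \<otimes>\<^bsub>char_group G\<^esub> \<psi> \<in> carrier (char_group G)"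
    by (auto intro!: circle_homI simp: circle_hom_norm norm_mult circle_hom_mult)
next
  fix \<xi> assume \<xi>: "\<xi> \<in> carrier (char_group G)"
  have "norm (\<xi> x) = 1" for x using \<xi> by (cases "x \<in> carrier G") (auto simp: circle_hom_norm)
  then have nz: "\<xi> x \<noteq> 0" for x by (metis norm_zero zero_neq_one)
  show "\<exists>\<psi>\<in>carrier (char_group G). \<psi> \<otimes>\<^bsub>char_group G\<^esub> \<xi> = \<one>\<^bsub>char_group G\<^esub>"
    using \<xi> nz
    by (intro bexI[of _ "\<lambda>x. inverse (\<xi> x)"])
      (auto intro!: circle_homI simp: circle_hom_norm norm_inverse circle_hom_mult)
qed (auto intro!: circle_homI)

lemma (in group) char_group_int_pow:
  assumes "\<xi> \<in> carrier (char_group G)" "x \<in> carrier G"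
  shows "(\<xi> [^]\<^bsub>char_group G\<^esub> (l::int)) x = \<xi> x [^]\<^bsub>circle\<^esub> l"
proof -
  interpret C: comm_group "char_group G" by (rule comm_group_char_group)
  have "(\<lambda>\<psi>. \<psi> x) \<in> hom (char_group G) circle"
    using assms by (intro circle_homI) (auto simp: circle_hom_norm)
  then show ?thesis
    using hom_int_pow[of "\<lambda>\<psi>. \<psi> x" "char_group G" circle \<xi> l] assms(1) C.is_group circle.is_group by simp
qed

text \<open>In the application M is A modulo \<open>A\<^sub>2D\<close>, Z is the centre of B, E is
  its intersection with D, and b is the commutator of A followed by a character \<xi> of
  \<open>A\<^sub>2\<close>. The assumption \<open>torsion\<close> is then the condition of the
  theorem as seen by \<xi>.\<close>

locale partial_pairing = M: comm_group M + Z: comm_group Z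
  for M :: "('m, 'r) monoid_scheme" and Z :: "('z, 's) monoid_scheme" +
  fixes E and b :: "'m \<Rightarrow> 'z \<Rightarrow> complex"
  assumes E: "subgroup E Z"
    and hom_right: "a \<in> carrier M \<Longrightarrow> b a \<in> hom (Z\<lparr>carrier := E\<rparr>) circle"
    and hom_left: "e \<in> E \<Longrightarrow> (\<lambda>a. b a e) \<in> hom M circle"
    and torsion: "q > 0 \<Longrightarrow> a \<in> carrier M \<Longrightarrow> w \<in> carrier Z \<Longrightarrow> a [^]\<^bsub>M\<^esub> (q::nat) = \<one>\<^bsub>M\<^esub> \<Longrightarrow>
      w [^]\<^bsub>Z\<^esub> q \<in> E \<Longrightarrow> b a (w [^]\<^bsub>Z\<^esub> q) = 1"
begin

text \<open>The prescribed values on \<open>E\<close> together with the value \<open>1\<close> on \<open>m\<close>-th powers, \<open>m\<close> the order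
  of \<open>y\<close>, are consistent precisely because of the torsion condition.\<close>

lemma extend_at:
  assumes y: "y \<in> carrier M"
  obtains \<gamma> where "\<gamma> \<in> hom Z circle" "\<And>e. e \<in> E \<Longrightarrow> \<gamma> e = b y e"
    and "\<And>w. w \<in> carrier Z \<Longrightarrow> \<gamma> (w [^]\<^bsub>Z\<^esub> M.ord y) = 1"
proof -
  let ?m = "M.ord y"
  have EZ: "e \<in> carrier Z" if "e \<in> E" for e using that E subgroup.subset by blast
  have oneE: "\<one>\<^bsub>Z\<^esub> \<in> E" using E by (rule subgroup.one_closed)
  have gE: "group (Z\<lparr>carrier := E\<rparr>)" using E by (simp add: Z.subgroup_imp_group)
  have b1: "b y \<one>\<^bsub>Z\<^esub> = 1" using group.circle_hom_one[OF gE hom_right[OF y]] by simp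
  \<comment> \<open>The character is built on the subgroup of products e w^m and then extended to Z,
    which preserves the values on E and on m-th powers.\<close>
  let ?X = "(Z\<lparr>carrier := E\<rparr>) \<times>\<times> Z"
  let ?p = "\<lambda>(e, w). e \<otimes>\<^bsub>Z\<^esub> w [^]\<^bsub>Z\<^esub> ?m" and ?h = "\<lambda>(e, w). b y e"
  have X: "group ?X" by (intro DirProd_group gE Z.is_group)
  have p: "?p \<in> hom ?X Z"
    by (rule homI) (auto simp: EZ Z.nat_pow_distrib Z.m_ac)
  have h: "?h \<in> hom ?X circle"
    using circle_hom_mult[OF hom_right[OF y]] circle_hom_norm[OF hom_right[OF y]]
    by (intro circle_homI) auto
  have ker: "?h x = \<one>\<^bsub>circle\<^esub>" if x: "x \<in> carrier ?X" and px: "?p x = \<one>\<^bsub>Z\<^esub>" for x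
  proof -
    obtain e w where ew: "x = (e, w)" "e \<in> E" "w \<in> carrier Z" using x by auto
    then have "e = inv\<^bsub>Z\<^esub> (w [^]\<^bsub>Z\<^esub> ?m)" using px EZ Z.inv_equality by force
    then have e: "e = (inv\<^bsub>Z\<^esub> w) [^]\<^bsub>Z\<^esub> ?m" using ew by (simp add: Z.nat_pow_inv)
    \<comment> \<open>Infinite order of y appears as \<open>?m = 0\<close>: then e is a zeroth
      power, hence 1. For positive \<open>?m\<close> the torsion condition applies, with q the order
      of y.\<close>
    have "b y e = 1"
    proof (cases "?m = 0")
      case True
      then show ?thesis using e b1 by simp
    next
      case False
      then show ?thesis using torsion[of ?m y "inv\<^bsub>Z\<^esub> w"] ew e y M.pow_ord_eq_1 by auto
    qed
    then show ?thesis using ew by simp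
  qed
  obtain h' where h': "h' \<in> hom (Z\<lparr>carrier := ?p ` carrier ?X\<rparr>) circle"
      "\<And>x. x \<in> carrier ?X \<Longrightarrow> h' (?p x) = ?h x"
    using hom_factor[OF X Z.is_group circle.is_group p h ker] by metis
  have "subgroup (?p ` carrier ?X) Z"
    using X p Z.is_group group_hom.img_is_subgroup[of ?X Z ?p]
    by (simp add: group_hom_def group_hom_axioms_def)
  then obtain \<gamma> where \<gamma>: "\<gamma> \<in> hom Z circle" "\<And>z. z \<in> ?p ` carrier ?X \<Longrightarrow> \<gamma> z = h' z"
    using Z.circle_hom_extend h'(1) by blast
  have \<gamma>p: "\<gamma> (e \<otimes>\<^bsub>Z\<^esub> w [^]\<^bsub>Z\<^esub> ?m) = b y e" if "e \<in> E" "w \<in> carrier Z" for e w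
    using \<gamma>(2)[of "?p (e, w)"] h'(2)[of "(e, w)"] that by force
  have "\<gamma> e = b y e" if "e \<in> E" for e
    using \<gamma>p[OF that Z.one_closed] EZ[OF that] by simp
  moreover have "\<gamma> (w [^]\<^bsub>Z\<^esub> ?m) = 1" if "w \<in> carrier Z" for w
    using \<gamma>p[OF oneE that] that b1 by simp
  ultimately show ?thesis using that \<gamma>(1) by blast
qed

text \<open>A pairing is treated as a homomorphism from M to the characters of Z, so that adding a
  cyclic summand generated by y becomes an instance of \<open>hom_extend_one\<close>, with the
  character of \<open>extend_at\<close> as the value at y. The induction generalises the tuple
  because \<open>cyclic_summand\<close> replaces it by another one for the same subgroup.\<close>

lemma extend_finitely_generated:
  assumes "finite I" "x \<in> I \<rightarrow> carrier M"
  shows "\<exists>\<phi>\<in>hom (M\<lparr>carrier := range (M.lincomb I x)\<rparr>) (char_group Z).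
    \<forall>a\<in>range (M.lincomb I x). \<forall>e\<in>E. \<phi> a e = b a e"
  using assms
proof (induction "card I" arbitrary: I x)
  case 0
  then have "I = {}" by simp
  then have r: "range (M.lincomb I x) = {\<one>\<^bsub>M\<^esub>}" by (auto simp: M.lincomb_def)
  have "(\<lambda>_ _. 1) \<in> hom (M\<lparr>carrier := {\<one>\<^bsub>M\<^esub>}\<rparr>) (char_group Z)"
    by (rule homI) (auto intro!: circle_homI)
  moreover have "b \<one>\<^bsub>M\<^esub> e = 1" if "e \<in> E" for e using M.circle_hom_one[OF hom_left[OF that]] .
  ultimately show ?case unfolding r by (intro bexI[of _ "\<lambda>_ _. 1"]) auto
next
  case (Suc n)
  then have "I \<noteq> {}" by auto
  obtain k x' where k: "k \<in> I" and x': "x' \<in> I \<rightarrow> carrier M"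
    and r: "range (M.lincomb I x') = range (M.lincomb I x)"
    and split: "\<And>l::int. x' k [^]\<^bsub>M\<^esub> l \<in> range (M.lincomb (I - {k}) x') \<Longrightarrow> x' k [^]\<^bsub>M\<^esub> l = \<one>\<^bsub>M\<^esub>"
    using M.cyclic_summand[OF \<open>finite I\<close> \<open>I \<noteq> {}\<close> \<open>x \<in> I \<rightarrow> carrier M\<close>] by blast
  define N where "N = range (M.lincomb (I - {k}) x')"
  define y where "y = x' k"
  have x'': "x' \<in> I - {k} \<rightarrow> carrier M" using x' by auto
  have N: "subgroup N M" unfolding N_def using Suc.prems x'' by (intro M.range_lincomb_subgroup) auto
  have "n = card (I - {k})" using Suc k by simp
  then obtain \<phi> where \<phi>: "\<phi> \<in> hom (M\<lparr>carrier := N\<rparr>) (char_group Z)"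
    and \<phi>E: "\<And>a e. a \<in> N \<Longrightarrow> e \<in> E \<Longrightarrow> \<phi> a e = b a e"
    using Suc.hyps(1)[of "I - {k}" x'] Suc.prems x'' unfolding N_def by blast
  have y: "y \<in> carrier M" unfolding y_def using x' k by auto
  obtain \<gamma>0 where \<gamma>0: "\<gamma>0 \<in> hom Z circle" "\<And>e. e \<in> E \<Longrightarrow> \<gamma>0 e = b y e"
    "\<And>w. w \<in> carrier Z \<Longrightarrow> \<gamma>0 (w [^]\<^bsub>Z\<^esub> M.ord y) = 1"
    using extend_at[OF y] by blast
  define \<gamma> where "\<gamma> z = (if z \<in> carrier Z then \<gamma>0 z else 1)" for z
  interpret C: comm_group "char_group Z" by (rule Z.comm_group_char_group)
  have \<gamma>: "\<gamma> \<in> carrier (char_group Z)"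
    using \<gamma>0(1) by (auto simp: \<gamma>_def intro!: circle_homI simp: circle_hom_mult circle_hom_norm)
  have "\<gamma> [^]\<^bsub>char_group Z\<^esub> int (M.ord y) = \<one>\<^bsub>char_group Z\<^esub>"
  proof
    fix z
    show "(\<gamma> [^]\<^bsub>char_group Z\<^esub> int (M.ord y)) z = \<one>\<^bsub>char_group Z\<^esub> z"
    proof (cases "z \<in> carrier Z")
      case True
      have "\<gamma> z [^]\<^bsub>circle\<^esub> int (M.ord y) = \<gamma> (z [^]\<^bsub>Z\<^esub> int (M.ord y))"
        using hom_int_pow[of \<gamma> Z circle z "int (M.ord y)"] \<gamma> True Z.is_group circle.is_group by simp
      then have "\<gamma> z [^]\<^bsub>circle\<^esub> int (M.ord y) = 1"
        using True \<gamma>0(3)[OF True] by (simp add: \<gamma>_def int_pow_int)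
      then show ?thesis by (simp add: Z.char_group_int_pow[OF \<gamma> True])
    next
      case False
      then show ?thesis using C.int_pow_closed[OF \<gamma>] by simp
    qed
  qed
  then have \<gamma>m: "\<gamma> [^]\<^bsub>char_group Z\<^esub> (int (M.ord y) * j) = \<one>\<^bsub>char_group Z\<^esub>" for j
    by (simp only: C.int_pow_pow[OF \<gamma>, symmetric] C.int_pow_one)
  \<comment> \<open>The sum is direct: a power of y in N is 1, so l is a multiple of the order m of
    y, and \<gamma>^l is trivial because \<gamma> was made trivial on m-th powers.\<close>
  have rel: "\<phi> (y [^]\<^bsub>M\<^esub> l) = \<gamma> [^]\<^bsub>char_group Z\<^esub> l" if "y [^]\<^bsub>M\<^esub> l \<in> N" for l :: int
  proof -
    have yl: "y [^]\<^bsub>M\<^esub> l = \<one>\<^bsub>M\<^esub>" using split that by (simp add: y_def N_def)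
    then obtain j where "l = int (M.ord y) * j" using M.int_pow_eq_id[OF y] by blast
    then have "\<gamma> [^]\<^bsub>char_group Z\<^esub> l = \<one>\<^bsub>char_group Z\<^esub>" using \<gamma>m by simp
    moreover have "\<phi> \<one>\<^bsub>M\<^esub> = \<one>\<^bsub>char_group Z\<^esub>"
      using hom_one[OF \<phi>] M.subgroup_imp_group[OF N] C.is_group by simp
    ultimately show ?thesis using yl by simp
  qed
  obtain \<psi> where "subgroup ((\<lambda>(n, l::int). n \<otimes>\<^bsub>M\<^esub> y [^]\<^bsub>M\<^esub> l) ` (N \<times> UNIV)) M"
    and \<psi>: "\<psi> \<in> hom (M\<lparr>carrier := (\<lambda>(n, l::int). n \<otimes>\<^bsub>M\<^esub> y [^]\<^bsub>M\<^esub> l) ` (N \<times> UNIV)\<rparr>) (char_group Z)"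
    and \<psi>ext: "\<And>n (l::int). n \<in> N \<Longrightarrow>
      \<psi> (n \<otimes>\<^bsub>M\<^esub> y [^]\<^bsub>M\<^esub> l) = \<phi> n \<otimes>\<^bsub>char_group Z\<^esub> \<gamma> [^]\<^bsub>char_group Z\<^esub> l"
    by (rule M.hom_extend_one[OF N C.comm_group_axioms \<phi> y \<gamma> rel]) (assumption, rule that)
  have range: "range (M.lincomb I x) = (\<lambda>(n, l::int). n \<otimes>\<^bsub>M\<^esub> y [^]\<^bsub>M\<^esub> l) ` (N \<times> UNIV)"
    using M.range_lincomb_remove[OF \<open>finite I\<close> k x'] r by (simp add: N_def y_def)
  have "\<psi> (n \<otimes>\<^bsub>M\<^esub> y [^]\<^bsub>M\<^esub> l) e = b (n \<otimes>\<^bsub>M\<^esub> y [^]\<^bsub>M\<^esub> l) e" if n: "n \<in> N" and e: "e \<in> E" for n e and l :: int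
  proof -
    have eZ: "e \<in> carrier Z" using e E subgroup.subset by blast
    have nM: "n \<in> carrier M" using n N subgroup.subset by blast
    have "\<psi> (n \<otimes>\<^bsub>M\<^esub> y [^]\<^bsub>M\<^esub> l) e = b n e * b y e [^]\<^bsub>circle\<^esub> l"
      using n e eZ by (simp add: \<psi>ext \<phi>E Z.char_group_int_pow[OF \<gamma> eZ] \<gamma>_def \<gamma>0(2))
    also have "b y e [^]\<^bsub>circle\<^esub> l = b (y [^]\<^bsub>M\<^esub> l) e"
      using hom_int_pow[OF hom_left[OF e] y M.is_group circle.is_group] by simp
    also have "b n e * \<dots> = b (n \<otimes>\<^bsub>M\<^esub> y [^]\<^bsub>M\<^esub> l) e"
      using circle_hom_mult[OF hom_left[OF e], of n "y [^]\<^bsub>M\<^esub> l"] nM y by simp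
    finally show ?thesis .
  qed
  then have "\<forall>a\<in>(\<lambda>(n, l::int). n \<otimes>\<^bsub>M\<^esub> y [^]\<^bsub>M\<^esub> l) ` (N \<times> UNIV). \<forall>e\<in>E. \<psi> a e = b a e" by auto
  then show ?case using \<psi> unfolding range by blast
qed

lemma extend:
  obtains \<beta> where "\<And>a. a \<in> carrier M \<Longrightarrow> \<beta> a \<in> hom Z circle"
    and "\<And>z. z \<in> carrier Z \<Longrightarrow> (\<lambda>a. \<beta> a z) \<in> hom M circle"
    and "\<And>a e. a \<in> carrier M \<Longrightarrow> e \<in> E \<Longrightarrow> \<beta> a e = b a e"
proof -
  have EZ: "e \<in> carrier Z" if "e \<in> E" for e using that E subgroup.subset by blast
  \<comment> \<open>Only the first argument is confined to S, because on a finitely generated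
    subgroup of M the preceding lemma already yields characters of all of Z. The set is still
    closed, as an intersection of conditions on finitely many coordinates each.\<close>
  define C where "C S = {f :: 'm \<times> 'z \<Rightarrow> complex.
    (\<forall>a\<in>S. \<forall>a'\<in>S. \<forall>z\<in>carrier Z. f (a \<otimes>\<^bsub>M\<^esub> a', z) = f (a, z) * f (a', z)) \<and>
    (\<forall>a\<in>S. \<forall>z\<in>carrier Z. \<forall>z'\<in>carrier Z. f (a, z \<otimes>\<^bsub>Z\<^esub> z') = f (a, z) * f (a, z')) \<and>
    (\<forall>a\<in>S. \<forall>e\<in>E. f (a, e) = b a e)}" for S
  obtain f where f: "\<And>x. norm (f x) = 1" "\<And>S. finite S \<Longrightarrow> S \<subseteq> carrier M \<Longrightarrow> f \<in> C S"
  proof (rule circle_function_compactness[of "carrier M" C])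
    fix S show "closed (C S)"
      unfolding C_def Ball_def
      by (intro closed_Collect_conj closed_Collect_all closed_Collect_imp open_Collect_const
          closed_Collect_eq continuous_intros continuous_on_product_coordinates)
  next
    fix S assume S: "finite S" "S \<subseteq> carrier M"
    define N where "N = range (M.lincomb S (\<lambda>a. a))"
    obtain \<phi> where \<phi>: "\<phi> \<in> hom (M\<lparr>carrier := N\<rparr>) (char_group Z)"
      "\<forall>a\<in>N. \<forall>e\<in>E. \<phi> a e = b a e"
      using extend_finitely_generated[OF S(1), of "\<lambda>a. a"] S(2) unfolding N_def by auto
    have N: "subgroup N M" unfolding N_def using S by (intro M.range_lincomb_subgroup) auto
    have SN: "S \<subseteq> N" unfolding N_def using M.generator_in_range_lincomb[OF S(1), of _ "\<lambda>a. a"] S(2) by auto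
    have \<phi>c: "\<phi> a \<in> carrier (char_group Z)" if "a \<in> N" for a
      using hom_in_carrier[OF \<phi>(1), of a] that by simp
    have \<phi>m: "\<phi> (a \<otimes>\<^bsub>M\<^esub> a') z = \<phi> a z * \<phi> a' z" if "a \<in> N" "a' \<in> N" for a a' z
      using hom_mult[OF \<phi>(1), of a a'] that by simp
    \<comment> \<open>Outside N the value is 1; for a in N and z outside Z the normalisation of
      \<open>char_group\<close> gives 1. So all values lie on the circle, as compactness
      demands.\<close>
    define f where "f = (\<lambda>(a, z). if a \<in> N then \<phi> a z else 1)"
    have "norm (f (a, z)) = 1" for a z
      using \<phi>c[of a] by (cases "z \<in> carrier Z") (auto simp: f_def circle_hom_norm)
    then have "\<forall>x. norm (f x) = 1" by auto
    moreover have "f (a \<otimes>\<^bsub>M\<^esub> a', z) = f (a, z) * f (a', z)" if "a \<in> N" "a' \<in> N" for a a' z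
      using that subgroup.m_closed[OF N] by (simp add: f_def \<phi>m)
    moreover have "f (a, z \<otimes>\<^bsub>Z\<^esub> z') = f (a, z) * f (a, z')"
      if "a \<in> N" "z \<in> carrier Z" "z' \<in> carrier Z" for a z z'
      using that \<phi>c[of a] by (simp add: f_def circle_hom_mult)
    moreover have "f (a, e) = b a e" if "a \<in> N" "e \<in> E" for a e
      using that \<phi>(2) by (simp add: f_def)
    ultimately have "f \<in> C S" "\<forall>x. norm (f x) = 1"
      using SN unfolding C_def by (blast, blast)
    then show "\<exists>f\<in>C S. \<forall>x. norm (f x) = 1" by blast
  next
    fix S S' :: "'m set" assume "S \<subseteq> S'"
    then show "C S' \<subseteq> C S" unfolding C_def by blast
  qed blast
  have 1: "f (a \<otimes>\<^bsub>M\<^esub> a', z) = f (a, z) * f (a', z)"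
    if "a \<in> carrier M" "a' \<in> carrier M" "z \<in> carrier Z" for a a' z
    using f(2)[of "{a, a'}"] that by (auto simp: C_def)
  have 2: "f (a, z \<otimes>\<^bsub>Z\<^esub> z') = f (a, z) * f (a, z')"
    if "a \<in> carrier M" "z \<in> carrier Z" "z' \<in> carrier Z" for a z z'
    using f(2)[of "{a}"] that by (auto simp: C_def)
  have 3: "f (a, e) = b a e" if "a \<in> carrier M" "e \<in> E" for a e
    using f(2)[of "{a}"] that by (auto simp: C_def)
  show ?thesis
    by (rule that[of "\<lambda>a z. f (a, z)"]) (auto intro!: circle_homI simp: 1 2 3 f(1))
qed

end

section \<open>Groups of class two and the central extension\<close>

context group
begin

lemma mult_inv_cancel:
  "x \<in> carrier G \<Longrightarrow> y \<in> carrier G \<Longrightarrow> x \<otimes> (inv x \<otimes> y) = y"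
  "x \<in> carrier G \<Longrightarrow> y \<in> carrier G \<Longrightarrow> inv x \<otimes> (x \<otimes> y) = y"
  by (simp_all flip: m_assoc)

lemma commutator_closed [simp]: "x \<in> carrier G \<Longrightarrow> y \<in> carrier G \<Longrightarrow> commutator G x y \<in> carrier G"
  by (simp add: commutator_def)

lemma commutator_in_derived:
  "x \<in> carrier G \<Longrightarrow> y \<in> carrier G \<Longrightarrow> commutator G x y \<in> derived G (carrier G)"
  unfolding derived_eq_generate_commutators by (intro generate.incl) blast

lemma commutator_swap: "x \<in> carrier G \<Longrightarrow> y \<in> carrier G \<Longrightarrow> y \<otimes> x \<otimes> commutator G x y = x \<otimes> y"
  by (simp add: commutator_def m_assoc mult_inv_cancel)

lemma commutator_unique:
  assumes "x \<in> carrier G" "y \<in> carrier G" "w \<in> carrier G" "x \<otimes> y = y \<otimes> x \<otimes> w"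
  shows "commutator G x y = w"
  using assms commutator_swap[OF assms(1,2)] Units_l_cancel[of "y \<otimes> x"] by simp

lemma commutator_eq_one_iff:
  assumes "x \<in> carrier G" "y \<in> carrier G"
  shows "commutator G x y = \<one> \<longleftrightarrow> x \<otimes> y = y \<otimes> x"
  using assms commutator_swap[OF assms] commutator_unique[OF assms one_closed] by auto

lemma center_subset: "center G \<subseteq> carrier G"
  by (auto simp: center_def)

lemma center_commutes: "z \<in> center G \<Longrightarrow> x \<in> carrier G \<Longrightarrow> z \<otimes> x = x \<otimes> z"
  by (auto simp: center_def)

lemma center_subgroup: "subgroup (center G) G"
proof (rule subgroupI)
  fix a assume a: "a \<in> center G"
  have "inv a \<otimes> x = x \<otimes> inv a" if "x \<in> carrier G" for x
  proof -
    have aG: "a \<in> carrier G" using a center_subset by blast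
    have "inv a \<otimes> x = inv a \<otimes> (x \<otimes> a) \<otimes> inv a" using aG that by (simp add: m_assoc)
    also have "\<dots> = x \<otimes> inv a"
      using aG that by (simp add: mult_inv_cancel flip: center_commutes[OF a that])
    finally show ?thesis .
  qed
  then show "inv a \<in> center G" using a by (auto simp: center_def)
next
  fix a b assume "a \<in> center G" "b \<in> center G"
  note ab = this and abG = this[THEN subsetD[OF center_subset]]
  have "a \<otimes> b \<otimes> x = x \<otimes> (a \<otimes> b)" if "x \<in> carrier G" for x
  proof -
    have "a \<otimes> b \<otimes> x = a \<otimes> (b \<otimes> x)" using abG that by (simp add: m_assoc)
    also have "b \<otimes> x = x \<otimes> b" using ab(2) that by (rule center_commutes)
    also have "a \<otimes> (x \<otimes> b) = a \<otimes> x \<otimes> b" using abG that by (simp add: m_assoc)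
    also have "a \<otimes> x = x \<otimes> a" using ab(1) that by (rule center_commutes)
    finally show ?thesis using abG that by (simp add: m_assoc)
  qed
  then show "a \<otimes> b \<in> center G" using abG unfolding center_def by blast
qed (auto simp: center_def)

lemma comm_group_center: "comm_group (G\<lparr>carrier := center G\<rparr>)"
  using subgroup_imp_group[OF center_subgroup] subsetD[OF center_subset]
  by (intro group.group_comm_groupI) (simp_all add: center_commutes)

text \<open>Elements of C move past those of H, so products and inverses can be reassembled. This is
  applied to the centre of B with D, where it describes B, and to \<open>A\<^sub>2\<close> with D,
  where it makes \<open>A\<^sub>2D\<close> a subgroup.\<close>

lemma central_set_mult:
  assumes C: "subgroup C G" "C \<subseteq> center G" and H: "subgroup H G"
  shows "C <#> H = H <#> C" and "subgroup (C <#> H) G"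
proof -
  have CG: "c \<in> carrier G" if "c \<in> C" for c using that C(1) subgroup.subset by blast
  have HG: "h \<in> carrier G" if "h \<in> H" for h using that H subgroup.subset by blast
  have comm: "c \<otimes> h = h \<otimes> c" if "c \<in> C" "h \<in> H" for c h
    using that C(2) HG by (intro center_commutes) auto
  show "C <#> H = H <#> C"
  proof (intro equalityI subsetI)
    fix a assume "a \<in> C <#> H"
    then obtain c h where "c \<in> C" "h \<in> H" "a = h \<otimes> c" unfolding set_mult_def using comm by force
    then show "a \<in> H <#> C" unfolding set_mult_def by blast
  next
    fix a assume "a \<in> H <#> C"
    then obtain c h where "c \<in> C" "h \<in> H" "a = c \<otimes> h" unfolding set_mult_def using comm by force
    then show "a \<in> C <#> H" unfolding set_mult_def by blast
  qed
  show "subgroup (C <#> H) G"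
  proof (rule subgroupI)
    show "C <#> H \<subseteq> carrier G" using CG HG by (auto simp: set_mult_def)
    show "C <#> H \<noteq> {}"
      using subgroup.one_closed[OF C(1)] subgroup.one_closed[OF H] by (auto simp: set_mult_def)
  next
    fix a assume "a \<in> C <#> H"
    then obtain c h where a: "c \<in> C" "h \<in> H" "a = c \<otimes> h" by (auto simp: set_mult_def)
    have "inv a = inv c \<otimes> inv h" using a comm[OF a(1,2)] CG HG by (simp add: inv_mult_group)
    then show "inv a \<in> C <#> H"
      using a subgroup.m_inv_closed[OF C(1)] subgroup.m_inv_closed[OF H] by (auto simp: set_mult_def)
  next
    fix a b assume "a \<in> C <#> H" "b \<in> C <#> H"
    then obtain c h c' h' where ab: "c \<in> C" "h \<in> H" "a = c \<otimes> h" "c' \<in> C" "h' \<in> H" "b = c' \<otimes> h'"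
      by (auto simp: set_mult_def)
    have "a \<otimes> b = c \<otimes> (h \<otimes> c') \<otimes> h'" using ab CG HG by (simp add: m_assoc)
    also have "h \<otimes> c' = c' \<otimes> h" using comm[of c' h] ab by simp
    finally have "a \<otimes> b = (c \<otimes> c') \<otimes> (h \<otimes> h')" using ab CG HG by (simp add: m_assoc)
    moreover have "c \<otimes> c' \<in> C" "h \<otimes> h' \<in> H"
      using ab subgroup.m_closed[OF C(1)] subgroup.m_closed[OF H] by simp_all
    ultimately show "a \<otimes> b \<in> C <#> H" unfolding set_mult_def by blast
  qed
qed

text \<open>Products of central elements with elements of H form a subgroup, and it contains H
  together with any central Z that witnesses cocentrality.\<close>

lemma cocentral_set_mult_center:
  assumes H: "subgroup H G" and "cocentral H G"
  shows "H <#> center G = carrier G"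
proof -
  obtain Z where Z: "Z \<subseteq> center G" "generate G (H \<union> Z) = carrier G"
    using assms(2) by (auto simp: cocentral_def)
  have sub: "subgroup (center G <#> H) G" and eq: "center G <#> H = H <#> center G"
    using central_set_mult[OF center_subgroup subset_refl H] by simp_all
  have HG: "h \<in> carrier G" if "h \<in> H" for h using that H subgroup.subset by blast
  have "h \<in> center G <#> H" if "h \<in> H" for h
    unfolding set_mult_def using that HG[OF that] subgroup.one_closed[OF center_subgroup] by force
  moreover have "z \<in> center G <#> H" if "z \<in> center G" for z
    unfolding set_mult_def using that subsetD[OF center_subset that] subgroup.one_closed[OF H] by force
  ultimately have "generate G (H \<union> Z) \<subseteq> center G <#> H"
    using Z(1) by (intro generate_subgroup_incl sub) auto
  then show ?thesis using Z(2) subgroup.subset[OF sub] eq by auto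
qed

text \<open>The equation forces w to be the commutator of x and y. So for a group given by explicit
  formulas or as a quotient it suffices to exhibit a central w.\<close>

lemma nilpotent_class2I:
  assumes "\<And>x y. x \<in> carrier G \<Longrightarrow> y \<in> carrier G \<Longrightarrow> \<exists>w\<in>center G. x \<otimes> y = y \<otimes> x \<otimes> w"
  shows "nilpotent_class2 G"
proof -
  have "commutator G x y \<in> center G" if "x \<in> carrier G" "y \<in> carrier G" for x y
    using assms[OF that] commutator_unique[OF that] center_subset by auto
  then show ?thesis
    unfolding nilpotent_class2_def derived_eq_generate_commutators
    by (intro conjI is_group generate_subgroup_incl center_subgroup) blast
qed

lemma subgroup_containing_derived:
  assumes N: "subgroup N G" and D: "derived G (carrier G) \<subseteq> N"
  shows "N \<lhd> G" and "comm_group (G Mod N)"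
proof -
  have NG: "n \<in> carrier G" if "n \<in> N" for n using that N subgroup.subset by blast
  have c: "commutator G x y \<in> N" if "x \<in> carrier G" "y \<in> carrier G" for x y
    using commutator_in_derived[OF that] D by blast
  show n: "N \<lhd> G"
  proof (rule normal_invI[OF N])
    fix x h assume h: "h \<in> N" and x: "x \<in> carrier G"
    have "x \<otimes> h \<otimes> inv x = h \<otimes> commutator G h (inv x)"
      using NG[OF h] x by (simp add: commutator_def m_assoc mult_inv_cancel)
    then show "x \<otimes> h \<otimes> inv x \<in> N"
      using subgroup.m_closed[OF N h c[of h "inv x"]] NG[OF h] x by simp
  qed
  then interpret N: normal N G .
  show "comm_group (G Mod N)"
  proof (rule group.group_comm_groupI[OF N.factorgroup_is_group])
    fix X Y assume "X \<in> carrier (G Mod N)" "Y \<in> carrier (G Mod N)"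
    then obtain x y where xy: "x \<in> carrier G" "y \<in> carrier G" "X = N #> x" "Y = N #> y"
      by (auto simp: carrier_FactGroup)
    have "x \<otimes> y = (commutator G (inv x) (inv y)) \<otimes> (y \<otimes> x)"
      using xy by (simp add: commutator_def m_assoc mult_inv_cancel)
    also have "N #> \<dots> = N #> commutator G (inv x) (inv y) #> (y \<otimes> x)"
      using xy by (simp add: coset_mult_assoc N.subset)
    also have "N #> commutator G (inv x) (inv y) = N"
      using xy by (intro coset_join2 N c) auto
    finally have "N #> (x \<otimes> y) = N #> (y \<otimes> x)" .
    then show "X \<otimes>\<^bsub>G Mod N\<^esub> Y = Y \<otimes>\<^bsub>G Mod N\<^esub> X"
      using xy by (simp add: N.rcos_sum)
  qed
qed

lemma hom_derived_trivial:
  assumes "comm_group T" and f: "f \<in> hom G T" and c: "c \<in> derived G (carrier G)"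
  shows "f c = \<one>\<^bsub>T\<^esub>"
proof -
  interpret T: comm_group T by fact
  interpret f: group_hom G T f using f by (simp add: group_hom_def group_hom_axioms_def T.is_group is_group)
  have "derived G (carrier G) \<subseteq> kernel G T f"
    unfolding derived_eq_generate_commutators
  proof (intro generate_subgroup_incl f.subgroup_kernel subsetI)
    fix u assume "u \<in> {commutator G x y | x y. x \<in> carrier G \<and> y \<in> carrier G}"
    then obtain x y where xy: "x \<in> carrier G" "y \<in> carrier G" "u = commutator G x y" by blast
    then have "f u = commutator T (f x) (f y)" by (simp add: commutator_def)
    also have "\<dots> = \<one>\<^bsub>T\<^esub>" using xy by (simp add: T.commutator_eq_one_iff T.m_comm)
    finally show "u \<in> kernel G T f" using xy by (simp add: kernel_def)
  qed
  then show ?thesis using c by (auto simp: kernel_def)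
qed

end

section \<open>Bilinearity of commutators in class two\<close>

locale class2_group = group G for G (structure) +
  assumes nilpotent: "nilpotent_class2 G"
begin

lemma derived_central: "c \<in> derived G (carrier G) \<Longrightarrow> x \<in> carrier G \<Longrightarrow> c \<otimes> x = x \<otimes> c"
  using nilpotent by (intro center_commutes) (auto simp: nilpotent_class2_def)

lemma commutator_central:
  "x \<in> carrier G \<Longrightarrow> y \<in> carrier G \<Longrightarrow> u \<in> carrier G \<Longrightarrow> commutator G x y \<otimes> u = u \<otimes> commutator G x y"
  by (intro derived_central commutator_in_derived)

lemma commutator_mult_left:
  assumes "x \<in> carrier G" "x' \<in> carrier G" "y \<in> carrier G"
  shows "commutator G (x \<otimes> x') y = commutator G x y \<otimes> commutator G x' y"
proof (rule commutator_unique)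
  let ?c = "commutator G x y" and ?c' = "commutator G x' y"
  note s = commutator_swap[OF assms(1,3)] commutator_swap[OF assms(2,3)]
  have "x \<otimes> x' \<otimes> y = x \<otimes> (y \<otimes> x' \<otimes> ?c')" unfolding s using assms by (simp add: m_assoc)
  also have "\<dots> = (x \<otimes> y) \<otimes> x' \<otimes> ?c'" using assms by (simp add: m_assoc)
  also have "\<dots> = (y \<otimes> x \<otimes> ?c) \<otimes> x' \<otimes> ?c'" unfolding s ..
  also have "\<dots> = y \<otimes> x \<otimes> (?c \<otimes> x') \<otimes> ?c'" using assms by (simp add: m_assoc)
  also have "?c \<otimes> x' = x' \<otimes> ?c" using assms by (intro commutator_central)
  finally show "x \<otimes> x' \<otimes> y = y \<otimes> (x \<otimes> x') \<otimes> (?c \<otimes> ?c')" using assms by (simp add: m_assoc)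
qed (use assms in auto)

lemma commutator_mult_right:
  assumes "x \<in> carrier G" "y \<in> carrier G" "y' \<in> carrier G"
  shows "commutator G x (y \<otimes> y') = commutator G x y \<otimes> commutator G x y'"
proof (rule commutator_unique)
  let ?c = "commutator G x y" and ?c' = "commutator G x y'"
  note s = commutator_swap[OF assms(1,2)] commutator_swap[OF assms(1,3)]
  have "x \<otimes> (y \<otimes> y') = (x \<otimes> y) \<otimes> y'" using assms by (simp add: m_assoc)
  also have "\<dots> = (y \<otimes> x \<otimes> ?c) \<otimes> y'" unfolding s ..
  also have "\<dots> = y \<otimes> x \<otimes> (?c \<otimes> y')" using assms by (simp add: m_assoc)
  also have "?c \<otimes> y' = y' \<otimes> ?c" using assms by (intro commutator_central)
  also have "y \<otimes> x \<otimes> (y' \<otimes> ?c) = y \<otimes> (x \<otimes> y') \<otimes> ?c" using assms by (simp add: m_assoc)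
  also have "\<dots> = y \<otimes> (y' \<otimes> x \<otimes> ?c') \<otimes> ?c" unfolding s ..
  also have "\<dots> = y \<otimes> y' \<otimes> x \<otimes> (?c' \<otimes> ?c)" using assms by (simp add: m_assoc)
  also have "?c' \<otimes> ?c = ?c \<otimes> ?c'" using assms by (intro commutator_central) auto
  finally show "x \<otimes> (y \<otimes> y') = y \<otimes> y' \<otimes> x \<otimes> (?c \<otimes> ?c')" .
qed (use assms in auto)

lemma commutator_nat_pow_left:
  "x \<in> carrier G \<Longrightarrow> y \<in> carrier G \<Longrightarrow> commutator G (x [^] (n::nat)) y = commutator G x y [^] n"
proof (induction n)
  case 0
  then show ?case by (simp add: commutator_eq_one_iff)
qed (simp add: commutator_mult_left)

lemma commutator_nat_pow_right:
  "x \<in> carrier G \<Longrightarrow> y \<in> carrier G \<Longrightarrow> commutator G x (y [^] (n::nat)) = commutator G x y [^] n"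
proof (induction n)
  case 0
  then show ?case by (simp add: commutator_eq_one_iff)
qed (simp add: commutator_mult_right)

lemma nilpotent_class2_Mod:
  assumes "N \<lhd> G"
  shows "nilpotent_class2 (G Mod N)"
proof -
  interpret N: normal N G by fact
  interpret Q: group "G Mod N" by (rule N.factorgroup_is_group)
  show ?thesis
  proof (rule Q.nilpotent_class2I)
    fix X Y assume "X \<in> carrier (G Mod N)" "Y \<in> carrier (G Mod N)"
    then obtain x y where xy: "x \<in> carrier G" "y \<in> carrier G" "X = N #> x" "Y = N #> y"
      by (auto simp: carrier_FactGroup)
    have "N #> commutator G x y \<in> center (G Mod N)"
      using xy by (auto simp: center_def carrier_FactGroup N.rcos_sum commutator_central)
    moreover have "X \<otimes>\<^bsub>G Mod N\<^esub> Y = Y \<otimes>\<^bsub>G Mod N\<^esub> X \<otimes>\<^bsub>G Mod N\<^esub> (N #> commutator G x y)"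
      using xy by (simp add: N.rcos_sum commutator_swap)
    ultimately show "\<exists>W\<in>center (G Mod N). X \<otimes>\<^bsub>G Mod N\<^esub> Y = Y \<otimes>\<^bsub>G Mod N\<^esub> X \<otimes>\<^bsub>G Mod N\<^esub> W" by blast
  qed
qed

end

section \<open>The central extension and its quotient, the amalgam\<close>

text \<open>The common subgroup is a subgroup \<open>H\<close> of \<open>B\<close>, embedded into \<open>A\<close> by \<open>\<iota>\<close>.\<close>

locale cocentral_amalgam = A: class2_group A + B: class2_group B
  for A :: "('a, 'r) monoid_scheme" and B :: "('b, 's) monoid_scheme" +
  fixes H :: "'b set" and \<iota> :: "'b \<Rightarrow> 'a"
  assumes H: "subgroup H B" and H_center: "H <#>\<^bsub>B\<^esub> center B = carrier B"
    and \<iota>: "\<iota> \<in> hom (B\<lparr>carrier := H\<rparr>) A" and \<iota>_inj: "inj_on \<iota> H"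
begin

lemma center_carrier [simp]: "z \<in> center B \<Longrightarrow> z \<in> carrier B"
  using B.center_subset by blast

lemma center_closed [simp]:
  "\<one>\<^bsub>B\<^esub> \<in> center B" "z \<in> center B \<Longrightarrow> z' \<in> center B \<Longrightarrow> z \<otimes>\<^bsub>B\<^esub> z' \<in> center B"
  "z \<in> center B \<Longrightarrow> inv\<^bsub>B\<^esub> z \<in> center B"
  using B.center_subgroup subgroup.one_closed subgroup.m_closed subgroup.m_inv_closed by metis+

lemma H_carrier [simp]: "h \<in> H \<Longrightarrow> h \<in> carrier B"
  using H subgroup.subset by blast

lemma H_closed [simp]:
  "\<one>\<^bsub>B\<^esub> \<in> H" "h \<in> H \<Longrightarrow> h' \<in> H \<Longrightarrow> h \<otimes>\<^bsub>B\<^esub> h' \<in> H" "h \<in> H \<Longrightarrow> inv\<^bsub>B\<^esub> h \<in> H"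
  using H subgroup.one_closed subgroup.m_closed subgroup.m_inv_closed by metis+

lemma derived_carrier [simp]: "c \<in> derived A (carrier A) \<Longrightarrow> c \<in> carrier A"
  using A.derived_in_carrier[of "carrier A"] by blast

lemma subgroup_derived: "subgroup (derived A (carrier A)) A"
  by (rule A.derived_is_subgroup) simp

lemma derived_closed [simp]:
  "\<one>\<^bsub>A\<^esub> \<in> derived A (carrier A)"
  "c \<in> derived A (carrier A) \<Longrightarrow> c' \<in> derived A (carrier A) \<Longrightarrow> c \<otimes>\<^bsub>A\<^esub> c' \<in> derived A (carrier A)"
  using subgroup_derived subgroup.one_closed subgroup.m_closed by metis+

lemma \<iota>_closed [simp]: "h \<in> H \<Longrightarrow> \<iota> h \<in> carrier A"
  using \<iota> hom_in_carrier by fastforce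

lemma \<iota>_mult [simp]: "h \<in> H \<Longrightarrow> h' \<in> H \<Longrightarrow> \<iota> (h \<otimes>\<^bsub>B\<^esub> h') = \<iota> h \<otimes>\<^bsub>A\<^esub> \<iota> h'"
  using hom_mult[OF \<iota>, of h h'] by simp

lemma \<iota>_one [simp]: "\<iota> \<one>\<^bsub>B\<^esub> = \<one>\<^bsub>A\<^esub>"
  using hom_one[OF \<iota>] B.subgroup_imp_group[OF H] A.is_group by simp

text \<open>Together with the centrality of \<open>A\<^sub>2\<close>, this makes the commutator of a
  with \<iota> e depend only on a modulo \<open>A\<^sub>2D\<close>.\<close>

lemma \<iota>_central: "h \<in> H \<Longrightarrow> e \<in> H \<Longrightarrow> e \<in> center B \<Longrightarrow> commutator A (\<iota> h) (\<iota> e) = \<one>\<^bsub>A\<^esub>"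
  using B.center_commutes[of e h] by (simp add: A.commutator_eq_one_iff flip: \<iota>_mult)

end

text \<open>The commutator of \<open>a\<close> in \<open>A\<close> and \<open>z\<close> in the centre of \<open>B\<close> is prescribed to be \<open>\<beta> a z\<close>, an
  element of a central subgroup \<open>T\<close> which contains \<open>[A,A]\<close> via \<open>\<phi>\<close>.\<close>

locale amalgam_data = cocentral_amalgam A B H \<iota> + T: comm_group T
  for A :: "('a, 'r) monoid_scheme" and B :: "('b, 's) monoid_scheme" and H \<iota>
    and T :: "('t, 'u) monoid_scheme" +
  fixes \<phi> :: "'a \<Rightarrow> 't" and \<beta> :: "'a \<Rightarrow> 'b \<Rightarrow> 't"
  assumes \<phi>: "\<phi> \<in> hom (A\<lparr>carrier := derived A (carrier A)\<rparr>) T" and \<phi>_inj: "inj_on \<phi> (derived A (carrier A))"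
    and \<beta>_left: "z \<in> center B \<Longrightarrow> (\<lambda>a. \<beta> a z) \<in> hom A T"
    and \<beta>_right: "a \<in> carrier A \<Longrightarrow> \<beta> a \<in> hom (B\<lparr>carrier := center B\<rparr>) T"
    and \<beta>_H: "h \<in> H \<Longrightarrow> z \<in> center B \<Longrightarrow> \<beta> (\<iota> h) z = \<one>\<^bsub>T\<^esub>"
    and \<beta>_commutator: "a \<in> carrier A \<Longrightarrow> e \<in> H \<Longrightarrow> e \<in> center B \<Longrightarrow> \<beta> a e = \<phi> (commutator A a (\<iota> e))"
begin

text \<open>The triple \<open>(a, t, z)\<close> stands for the product \<open>z t a\<close>, so that \<open>a z' = z' a \<beta>(a, z')\<close> gives
  the second component of a product.\<close>

definition extension :: "('a \<times> 't \<times> 'b) monoid" where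
  "extension = \<lparr>carrier = carrier A \<times> carrier T \<times> center B,
     mult = (\<lambda>(a, t, z) (a', t', z'). (a \<otimes>\<^bsub>A\<^esub> a', t \<otimes>\<^bsub>T\<^esub> t' \<otimes>\<^bsub>T\<^esub> \<beta> a z', z \<otimes>\<^bsub>B\<^esub> z')),
     one = (\<one>\<^bsub>A\<^esub>, \<one>\<^bsub>T\<^esub>, \<one>\<^bsub>B\<^esub>)\<rparr>"

lemma extension_simps [simp]:
  "(a, t, z) \<in> carrier extension \<longleftrightarrow> a \<in> carrier A \<and> t \<in> carrier T \<and> z \<in> center B"
  "(a, t, z) \<otimes>\<^bsub>extension\<^esub> (a', t', z') = (a \<otimes>\<^bsub>A\<^esub> a', t \<otimes>\<^bsub>T\<^esub> t' \<otimes>\<^bsub>T\<^esub> \<beta> a z', z \<otimes>\<^bsub>B\<^esub> z')"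
  "\<one>\<^bsub>extension\<^esub> = (\<one>\<^bsub>A\<^esub>, \<one>\<^bsub>T\<^esub>, \<one>\<^bsub>B\<^esub>)"
  by (simp_all add: extension_def)

lemma \<phi>_closed [simp]: "c \<in> derived A (carrier A) \<Longrightarrow> \<phi> c \<in> carrier T"
  using \<phi> hom_in_carrier by fastforce

lemma \<phi>_mult [simp]: "c \<in> derived A (carrier A) \<Longrightarrow> c' \<in> derived A (carrier A) \<Longrightarrow>
    \<phi> (c \<otimes>\<^bsub>A\<^esub> c') = \<phi> c \<otimes>\<^bsub>T\<^esub> \<phi> c'"
  using hom_mult[OF \<phi>, of c c'] by simp

lemma \<phi>_one [simp]: "\<phi> \<one>\<^bsub>A\<^esub> = \<one>\<^bsub>T\<^esub>"
  using hom_one[OF \<phi>] A.subgroup_imp_group[OF subgroup_derived] T.is_group by simp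

lemma \<beta>_closed [simp]: "a \<in> carrier A \<Longrightarrow> z \<in> center B \<Longrightarrow> \<beta> a z \<in> carrier T"
  using \<beta>_left hom_in_carrier by fastforce

lemma \<beta>_mult_left [simp]: "a \<in> carrier A \<Longrightarrow> a' \<in> carrier A \<Longrightarrow> z \<in> center B \<Longrightarrow>
    \<beta> (a \<otimes>\<^bsub>A\<^esub> a') z = \<beta> a z \<otimes>\<^bsub>T\<^esub> \<beta> a' z"
  using hom_mult[OF \<beta>_left] by simp

lemma \<beta>_mult_right [simp]: "a \<in> carrier A \<Longrightarrow> z \<in> center B \<Longrightarrow> z' \<in> center B \<Longrightarrow>
    \<beta> a (z \<otimes>\<^bsub>B\<^esub> z') = \<beta> a z \<otimes>\<^bsub>T\<^esub> \<beta> a z'"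
  using hom_mult[OF \<beta>_right, of a z z'] by simp

lemma \<beta>_one_left [simp]: "z \<in> center B \<Longrightarrow> \<beta> \<one>\<^bsub>A\<^esub> z = \<one>\<^bsub>T\<^esub>"
  using hom_one[OF \<beta>_left A.is_group T.is_group] by simp

lemma \<beta>_one_right [simp]: "a \<in> carrier A \<Longrightarrow> \<beta> a \<one>\<^bsub>B\<^esub> = \<one>\<^bsub>T\<^esub>"
  using hom_one[OF \<beta>_right] B.subgroup_imp_group[OF B.center_subgroup] T.is_group by simp

lemma \<beta>_derived [simp]: "c \<in> derived A (carrier A) \<Longrightarrow> z \<in> center B \<Longrightarrow> \<beta> c z = \<one>\<^bsub>T\<^esub>"
  using A.hom_derived_trivial[OF T.comm_group_axioms \<beta>_left] by simp

lemma \<beta>_inv_right: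
  assumes "a \<in> carrier A" "z \<in> center B"
  shows "\<beta> a (inv\<^bsub>B\<^esub> z) = inv\<^bsub>T\<^esub> \<beta> a z"
proof -
  have "\<beta> a (inv\<^bsub>B\<^esub> z) \<otimes>\<^bsub>T\<^esub> \<beta> a z = \<one>\<^bsub>T\<^esub>"
    using assms by (simp flip: \<beta>_mult_right)
  then show ?thesis using assms by (simp add: T.inv_equality)
qed

text \<open>A bilinear map is a 2-cocycle: in either bracketing of a triple product the second
  component collects \<beta> a z', \<beta> a z'' and \<beta> a' z''.\<close>

lemma group_extension: "group extension"
proof (rule groupI)
  fix x y u assume "x \<in> carrier extension" "y \<in> carrier extension" "u \<in> carrier extension"
  then show "x \<otimes>\<^bsub>extension\<^esub> y \<otimes>\<^bsub>extension\<^esub> u = x \<otimes>\<^bsub>extension\<^esub> (y \<otimes>\<^bsub>extension\<^esub> u)"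
    by (cases x, cases y, cases u) (auto simp: A.m_assoc B.m_assoc T.m_ac)
next
  fix x assume "x \<in> carrier extension"
  then obtain a t z where x: "x = (a, t, z)" "a \<in> carrier A" "t \<in> carrier T" "z \<in> center B"
    by (cases x) auto
  \<comment> \<open>The factor with \<beta> cancels the term that multiplication by x adds to the
    second component.\<close>
  let ?y = "(inv\<^bsub>A\<^esub> a, inv\<^bsub>T\<^esub> t \<otimes>\<^bsub>T\<^esub> inv\<^bsub>T\<^esub> \<beta> (inv\<^bsub>A\<^esub> a) z, inv\<^bsub>B\<^esub> z)"
  have "?y \<otimes>\<^bsub>extension\<^esub> x = \<one>\<^bsub>extension\<^esub>"
    using x by (simp add: T.m_ac)
  moreover have "?y \<in> carrier extension" using x by simp
  ultimately show "\<exists>y\<in>carrier extension. y \<otimes>\<^bsub>extension\<^esub> x = \<one>\<^bsub>extension\<^esub>" by blast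
next
  fix x y assume "x \<in> carrier extension" "y \<in> carrier extension"
  then show "x \<otimes>\<^bsub>extension\<^esub> y \<in> carrier extension" by (cases x, cases y) auto
next
  fix x assume "x \<in> carrier extension"
  then show "\<one>\<^bsub>extension\<^esub> \<otimes>\<^bsub>extension\<^esub> x = x" by (cases x) auto
qed simp

sublocale X: group extension by (rule group_extension)

lemma nilpotent_class2_extension: "nilpotent_class2 extension"
proof (rule X.nilpotent_class2I)
  fix x y assume "x \<in> carrier extension" "y \<in> carrier extension"
  then obtain a t z a' t' z' where x: "x = (a, t, z)" "a \<in> carrier A" "t \<in> carrier T" "z \<in> center B"
    and y: "y = (a', t', z')" "a' \<in> carrier A" "t' \<in> carrier T" "z' \<in> center B"
    by (cases x, cases y) auto
  \<comment> \<open>Found by comparing the components of x y and y x. It is central because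
    \<open>A\<^sub>2\<close> is central in A and \<beta> vanishes on \<open>A\<^sub>2\<close> and at
    1.\<close>
  define w where "w = (commutator A a a', \<beta> a z' \<otimes>\<^bsub>T\<^esub> inv\<^bsub>T\<^esub> \<beta> a' z, \<one>\<^bsub>B\<^esub>)"
  have c: "commutator A a a' \<in> derived A (carrier A)" using x y by (simp add: A.commutator_in_derived)
  have wX: "w \<in> carrier extension" using x y by (simp add: w_def)
  have "w \<otimes>\<^bsub>extension\<^esub> v = v \<otimes>\<^bsub>extension\<^esub> w" if v: "v \<in> carrier extension" for v
  proof -
    obtain a'' t'' z'' where v: "v = (a'', t'', z'')" "a'' \<in> carrier A" "t'' \<in> carrier T" "z'' \<in> center B"
      using v by (cases v) auto
    then have "commutator A a a' \<otimes>\<^bsub>A\<^esub> a'' = a'' \<otimes>\<^bsub>A\<^esub> commutator A a a'"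
      using x y by (intro A.commutator_central)
    then show ?thesis using x y v c by (simp add: w_def T.m_comm)
  qed
  then have "w \<in> center extension" using wX unfolding center_def by blast
  moreover have "x \<otimes>\<^bsub>extension\<^esub> y = y \<otimes>\<^bsub>extension\<^esub> x \<otimes>\<^bsub>extension\<^esub> w"
  proof -
    have "\<beta> a' z \<otimes>\<^bsub>T\<^esub> (\<beta> a z' \<otimes>\<^bsub>T\<^esub> inv\<^bsub>T\<^esub> \<beta> a' z) = \<beta> a z'"
      using x y by (simp add: T.m_comm[of "\<beta> a z'"] T.mult_inv_cancel)
    then have "t \<otimes>\<^bsub>T\<^esub> t' \<otimes>\<^bsub>T\<^esub> \<beta> a z' = t' \<otimes>\<^bsub>T\<^esub> t \<otimes>\<^bsub>T\<^esub> \<beta> a' z \<otimes>\<^bsub>T\<^esub> (\<beta> a z' \<otimes>\<^bsub>T\<^esub> inv\<^bsub>T\<^esub> \<beta> a' z)"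
      using x y by (simp add: T.m_assoc T.m_comm[of t t'] flip: T.m_assoc[of t t'])
    moreover have "z \<otimes>\<^bsub>B\<^esub> z' = z' \<otimes>\<^bsub>B\<^esub> z" using x y by (simp add: B.center_commutes)
    ultimately show ?thesis using x y by (simp add: w_def A.commutator_swap)
  qed
  ultimately show "\<exists>w\<in>center extension. x \<otimes>\<^bsub>extension\<^esub> y = y \<otimes>\<^bsub>extension\<^esub> x \<otimes>\<^bsub>extension\<^esub> w" by blast
qed

sublocale X: class2_group extension
  by unfold_locales (rule nilpotent_class2_extension)

text \<open>Under the reading z t a, making this element trivial identifies c with \<phi> c, and e
  in the centre of B with its copy \<iota> e in A.\<close>

definition relator :: "'a \<times> 'b \<Rightarrow> 'a \<times> 't \<times> 'b" where
  "relator = (\<lambda>(c, e). (c \<otimes>\<^bsub>A\<^esub> \<iota> e, inv\<^bsub>T\<^esub> \<phi> c, inv\<^bsub>B\<^esub> e))"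

definition relators :: "('a \<times> 't \<times> 'b) set" where
  "relators = relator ` (derived A (carrier A) \<times> (H \<inter> center B))"

lemma relatorsE:
  assumes "x \<in> relators"
  obtains c e where "c \<in> derived A (carrier A)" "e \<in> H" "e \<in> center B"
    "x = (c \<otimes>\<^bsub>A\<^esub> \<iota> e, inv\<^bsub>T\<^esub> \<phi> c, inv\<^bsub>B\<^esub> e)"
  using assms unfolding relators_def relator_def by (clarsimp simp del: Pair_inject)

text \<open>The relators form a subgroup because \<beta> vanishes on \<open>A\<^sub>2\<close> and on
  the image of D, so no twist arises in their products. Normality is the point where \<beta> has to
  agree with the commutator of A on D \<inter> Z(B).\<close>

lemma relators_normal: "relators \<lhd> extension"
proof (rule X.normal_invI)
  let ?P = "(A\<lparr>carrier := derived A (carrier A)\<rparr>) \<times>\<times> (B\<lparr>carrier := H \<inter> center B\<rparr>)"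
  have E: "subgroup (H \<inter> center B) B" by (rule B.subgroups_Inter_pair[OF H B.center_subgroup])
  have P: "group ?P"
    by (intro DirProd_group A.subgroup_imp_group B.subgroup_imp_group subgroup_derived E)
  have "relator \<in> hom ?P extension"
  proof (rule homI)
    fix x y assume "x \<in> carrier ?P" "y \<in> carrier ?P"
    then obtain c e c' e' where x: "x = (c, e)" "c \<in> derived A (carrier A)" "e \<in> H" "e \<in> center B"
      and y: "y = (c', e')" "c' \<in> derived A (carrier A)" "e' \<in> H" "e' \<in> center B"
      by (cases x, cases y) auto
    have "\<iota> e \<otimes>\<^bsub>A\<^esub> (c' \<otimes>\<^bsub>A\<^esub> \<iota> e') = c' \<otimes>\<^bsub>A\<^esub> (\<iota> e \<otimes>\<^bsub>A\<^esub> \<iota> e')"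
      using x y A.derived_central[of c' "\<iota> e"] by (simp flip: A.m_assoc)
    moreover have "inv\<^bsub>B\<^esub> (e \<otimes>\<^bsub>B\<^esub> e') = inv\<^bsub>B\<^esub> e \<otimes>\<^bsub>B\<^esub> inv\<^bsub>B\<^esub> e'"
      using x y by (simp add: B.inv_mult_group B.center_commutes)
    ultimately show "relator (x \<otimes>\<^bsub>?P\<^esub> y) = relator x \<otimes>\<^bsub>extension\<^esub> relator y"
      using x y by (simp add: relator_def A.m_assoc T.inv_mult \<beta>_H)
  qed (auto simp: relator_def)
  then have "group_hom ?P extension relator"
    using P X.is_group by (simp add: group_hom_def group_hom_axioms_def)
  then show "subgroup relators extension"
    using group_hom.img_is_subgroup by (fastforce simp: relators_def)
next
  fix x h assume "h \<in> relators" and "x \<in> carrier extension"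
  then obtain c e a t z where h: "h = relator (c, e)" "c \<in> derived A (carrier A)" "e \<in> H" "e \<in> center B"
    and x: "x = (a, t, z)" "a \<in> carrier A" "t \<in> carrier T" "z \<in> center B"
    by (cases x) (auto simp: relators_def)
  \<comment> \<open>Conjugation by a turns \<iota> e into [a, \<iota> e] \<iota> e, so c is
    multiplied by [a, \<iota> e]; the matching factor in T comes from \<beta> a (e^-1).\<close>
  define h' where "h' = relator (c \<otimes>\<^bsub>A\<^esub> commutator A a (\<iota> e), e)"
  have d: "commutator A a (\<iota> e) \<in> derived A (carrier A)" using x h by (simp add: A.commutator_in_derived)
  have h': "h' \<in> relators" using h d by (auto simp: h'_def relators_def)
  have "a \<otimes>\<^bsub>A\<^esub> (c \<otimes>\<^bsub>A\<^esub> \<iota> e) = c \<otimes>\<^bsub>A\<^esub> commutator A a (\<iota> e) \<otimes>\<^bsub>A\<^esub> \<iota> e \<otimes>\<^bsub>A\<^esub> a"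
  proof -
    have "a \<otimes>\<^bsub>A\<^esub> (c \<otimes>\<^bsub>A\<^esub> \<iota> e) = c \<otimes>\<^bsub>A\<^esub> (a \<otimes>\<^bsub>A\<^esub> \<iota> e)"
      using h x A.derived_central[of c a] by (simp flip: A.m_assoc)
    also have "a \<otimes>\<^bsub>A\<^esub> \<iota> e = commutator A a (\<iota> e) \<otimes>\<^bsub>A\<^esub> (\<iota> e \<otimes>\<^bsub>A\<^esub> a)"
      using h x A.commutator_swap[of a "\<iota> e"] A.derived_central[OF d, of "\<iota> e \<otimes>\<^bsub>A\<^esub> a"] by simp
    finally show ?thesis using h x by (simp add: A.m_assoc)
  qed
  moreover have "\<beta> a (inv\<^bsub>B\<^esub> e) = inv\<^bsub>T\<^esub> \<phi> (commutator A a (\<iota> e))"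
    using h x \<beta>_inv_right[of a e] \<beta>_commutator[of a e] by simp
  moreover have "z \<otimes>\<^bsub>B\<^esub> inv\<^bsub>B\<^esub> e = inv\<^bsub>B\<^esub> e \<otimes>\<^bsub>B\<^esub> z"
    using h x by (simp add: B.center_commutes)
  ultimately have "x \<otimes>\<^bsub>extension\<^esub> h = h' \<otimes>\<^bsub>extension\<^esub> x"
    using h x d
    by (simp add: relator_def h'_def \<beta>_H T.inv_mult T.m_ac)
  then have "x \<otimes>\<^bsub>extension\<^esub> h \<otimes>\<^bsub>extension\<^esub> inv\<^bsub>extension\<^esub> x = h'"
    using x h d by (simp add: relator_def h'_def X.m_assoc del: extension_simps(2))
  then show "x \<otimes>\<^bsub>extension\<^esub> h \<otimes>\<^bsub>extension\<^esub> inv\<^bsub>extension\<^esub> x \<in> relators" using h' by simp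
qed

text \<open>A relator with trivial T-component has c = 1, since \<phi> is injective; this makes both
  embeddings injective. For B, the injectivity of \<iota> then gives h = e = z^-1.\<close>

lemma amalgam:
  obtains G :: "('a \<times> 't \<times> 'b) set monoid" and f g
  where "nilpotent_class2 G" "f \<in> mon A G" "g \<in> mon B G" "\<And>h. h \<in> H \<Longrightarrow> f (\<iota> h) = g h"
proof -
  interpret K: normal relators extension by (rule relators_normal)
  let ?G = "extension Mod relators"
  interpret G: group ?G by (rule K.factorgroup_is_group)
  define q where "q x = relators #>\<^bsub>extension\<^esub> x" for x
  have q: "q \<in> hom extension ?G" unfolding q_def by (rule K.r_coset_hom_Mod)
  have q_one: "x \<in> relators" if "x \<in> carrier extension" "q x = \<one>\<^bsub>?G\<^esub>" for x
    using that X.coset_join1[of relators x] K.subset K.is_subgroup by (simp add: q_def)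
  have q_relator: "q x = \<one>\<^bsub>?G\<^esub>" if "x \<in> relators" for x
    using that X.coset_join2[of x relators] K.subset K.is_subgroup by (auto simp: q_def)

  define f where "f a = q (a, \<one>\<^bsub>T\<^esub>, \<one>\<^bsub>B\<^esub>)" for a
  have f: "f \<in> hom A ?G"
    using hom_mult[OF q, symmetric] hom_in_carrier[OF q] by (intro homI) (auto simp: f_def)
  interpret f: group_hom A ?G f
    using f by (simp add: group_hom_def group_hom_axioms_def A.is_group G.is_group)
  have "a = \<one>\<^bsub>A\<^esub>" if a: "a \<in> carrier A" "f a = \<one>\<^bsub>?G\<^esub>" for a
  proof -
    have r: "(a, \<one>\<^bsub>T\<^esub>, \<one>\<^bsub>B\<^esub>) \<in> relators" using q_one a by (simp add: f_def)
    obtain c e where ce: "c \<in> derived A (carrier A)" "e \<in> H" "e \<in> center B"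
      and eq: "(a, \<one>\<^bsub>T\<^esub>, \<one>\<^bsub>B\<^esub>) = (c \<otimes>\<^bsub>A\<^esub> \<iota> e, inv\<^bsub>T\<^esub> \<phi> c, inv\<^bsub>B\<^esub> e)"
      by (rule relatorsE[OF r]) (rule that)
    from eq have "a = c \<otimes>\<^bsub>A\<^esub> \<iota> e" "inv\<^bsub>T\<^esub> \<phi> c = \<one>\<^bsub>T\<^esub>" "inv\<^bsub>B\<^esub> e = \<one>\<^bsub>B\<^esub>"
      by simp_all
    note ce = ce this
    then have "\<phi> c = \<phi> \<one>\<^bsub>A\<^esub>" "e = \<one>\<^bsub>B\<^esub>" by (simp_all add: T.inv_eq_1_iff B.inv_eq_1_iff)
    then show ?thesis using ce inj_onD[OF \<phi>_inj, of c "\<one>\<^bsub>A\<^esub>"] by simp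
  qed
  then have f_mon: "f \<in> mon A ?G" using f f.inj_on_one_iff by (auto simp: mon_def)

  \<comment> \<open>B consists of the products h z, and h z should go to the class of (\<iota> h, 1,
    z). On pairs this is multiplicative since \<beta> vanishes on \<iota> h; it descends to B
    because h z = 1 makes the triple the relator of (1, h).\<close>
  let ?P = "(B\<lparr>carrier := H\<rparr>) \<times>\<times> (B\<lparr>carrier := center B\<rparr>)"
  let ?p = "\<lambda>(h, z). h \<otimes>\<^bsub>B\<^esub> z" and ?g = "\<lambda>(h, z). q (\<iota> h, \<one>\<^bsub>T\<^esub>, z)"
  have P: "group ?P"
    by (intro DirProd_group B.subgroup_imp_group H B.center_subgroup)
  have "h \<otimes>\<^bsub>B\<^esub> h' \<otimes>\<^bsub>B\<^esub> (z \<otimes>\<^bsub>B\<^esub> z') = h \<otimes>\<^bsub>B\<^esub> z \<otimes>\<^bsub>B\<^esub> (h' \<otimes>\<^bsub>B\<^esub> z')"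
    if "h \<in> H" "h' \<in> H" "z \<in> center B" "z' \<in> center B" for h h' z z'
  proof -
    have "h' \<otimes>\<^bsub>B\<^esub> (z \<otimes>\<^bsub>B\<^esub> z') = z \<otimes>\<^bsub>B\<^esub> (h' \<otimes>\<^bsub>B\<^esub> z')"
      using that B.center_commutes[of z h'] by (simp flip: B.m_assoc)
    then show ?thesis using that by (simp add: B.m_assoc)
  qed
  then have p: "?p \<in> hom ?P B" by (intro homI) auto
  have g0: "?g \<in> hom ?P ?G"
    using hom_mult[OF q, symmetric] hom_in_carrier[OF q] by (intro homI) (auto simp: \<beta>_H)
  have ker: "?g x = \<one>\<^bsub>?G\<^esub>" if x: "x \<in> carrier ?P" and px: "?p x = \<one>\<^bsub>B\<^esub>" for x
  proof -
    obtain h z where hz: "x = (h, z)" "h \<in> H" "z \<in> center B" using x by auto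
    then have "h = inv\<^bsub>B\<^esub> z" using px B.inv_equality[of h z] by simp
    then have "h \<in> center B" "z = inv\<^bsub>B\<^esub> h" using hz by auto
    then have "(\<iota> h, \<one>\<^bsub>T\<^esub>, z) = relator (\<one>\<^bsub>A\<^esub>, h)" using hz by (simp add: relator_def)
    then have "(\<iota> h, \<one>\<^bsub>T\<^esub>, z) \<in> relators" using hz \<open>h \<in> center B\<close> by (auto simp: relators_def)
    then show ?thesis using q_relator hz by simp
  qed
  obtain g where g: "g \<in> hom (B\<lparr>carrier := ?p ` carrier ?P\<rparr>) ?G"
      "\<And>x. x \<in> carrier ?P \<Longrightarrow> g (?p x) = ?g x"
    by (rule hom_factor[OF P B.is_group G.is_group p g0 ker]) (assumption, assumption, rule that)
  have "?p ` carrier ?P = H <#>\<^bsub>B\<^esub> center B" by (auto simp: set_mult_def)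
  then have img: "?p ` carrier ?P = carrier B" using H_center by simp
  then have g_hom: "g \<in> hom B ?G" using g(1) by simp
  interpret g: group_hom B ?G g
    using g_hom by (simp add: group_hom_def group_hom_axioms_def B.is_group G.is_group)
  have "b = \<one>\<^bsub>B\<^esub>" if b: "b \<in> carrier B" "g b = \<one>\<^bsub>?G\<^esub>" for b
  proof -
    obtain h z where hz: "b = h \<otimes>\<^bsub>B\<^esub> z" "h \<in> H" "z \<in> center B"
      using b(1) unfolding img[symmetric] by auto
    then have r: "(\<iota> h, \<one>\<^bsub>T\<^esub>, z) \<in> relators" using q_one g(2)[of "(h, z)"] b by simp
    obtain c e where ce: "c \<in> derived A (carrier A)" "e \<in> H" "e \<in> center B"
      and eq: "(\<iota> h, \<one>\<^bsub>T\<^esub>, z) = (c \<otimes>\<^bsub>A\<^esub> \<iota> e, inv\<^bsub>T\<^esub> \<phi> c, inv\<^bsub>B\<^esub> e)"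
      by (rule relatorsE[OF r]) (rule that)
    from eq have "\<iota> h = c \<otimes>\<^bsub>A\<^esub> \<iota> e" "inv\<^bsub>T\<^esub> \<phi> c = \<one>\<^bsub>T\<^esub>" "z = inv\<^bsub>B\<^esub> e"
      by simp_all
    note ce = ce this
    then have "\<phi> c = \<phi> \<one>\<^bsub>A\<^esub>" by (simp add: T.inv_eq_1_iff)
    then have "\<iota> h = \<iota> e" using ce inj_onD[OF \<phi>_inj, of c "\<one>\<^bsub>A\<^esub>"] by simp
    then have "h = e" using inj_onD[OF \<iota>_inj] ce hz by blast
    then show ?thesis using ce hz by simp
  qed
  then have g_mon: "g \<in> mon B ?G" using g_hom g.inj_on_one_iff by (auto simp: mon_def)
  have "f (\<iota> h) = g h" if "h \<in> H" for h using g(2)[of "(h, \<one>\<^bsub>B\<^esub>)"] that by (simp add: f_def)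
  then show ?thesis using that X.nilpotent_class2_Mod[OF relators_normal] f_mon g_mon by blast
qed

end

section \<open>The torsion condition\<close>

context cocentral_amalgam
begin

lemma
  defines "N \<equiv> derived A (carrier A) <#>\<^bsub>A\<^esub> \<iota> ` H"
  shows normal_derived_image: "N \<lhd> A" and comm_group_Mod_derived_image: "comm_group (A Mod N)"
    and image_in_derived_image: "\<iota> ` H \<subseteq> N"
proof -
  have sub\<iota>: "subgroup (\<iota> ` H) A"
    using group_hom.img_is_subgroup[of "B\<lparr>carrier := H\<rparr>" A \<iota>] \<iota> B.subgroup_imp_group[OF H] A.is_group
    by (simp add: group_hom_def group_hom_axioms_def)
  have "derived A (carrier A) \<subseteq> center A"
    using A.nilpotent by (simp add: nilpotent_class2_def)
  then have N: "subgroup N A"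
    unfolding N_def using A.central_set_mult(2)[OF subgroup_derived _ sub\<iota>] by simp
  have "c \<in> N" if "c \<in> derived A (carrier A)" for c
    unfolding N_def set_mult_def using that \<iota>_one
    by (auto intro!: bexI[of _ c] bexI[of _ "\<one>\<^bsub>B\<^esub>"])
  then have D: "derived A (carrier A) \<subseteq> N" by blast
  show "N \<lhd> A" "comm_group (A Mod N)"
    using A.subgroup_containing_derived[OF N D] by simp_all
  show "\<iota> ` H \<subseteq> N"
  proof
    fix u assume u: "u \<in> \<iota> ` H"
    then have "u = \<one>\<^bsub>A\<^esub> \<otimes>\<^bsub>A\<^esub> u" by auto
    then show "u \<in> N" unfolding N_def set_mult_def using u derived_closed(1) by blast
  qed
qed

text \<open>For fixed e, the map sending a to \<xi> of [a, \<iota> e] factors through A modulo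
  \<open>A\<^sub>2D\<close>, so the extension takes place over that quotient. Pulling it back to A
  yields the vanishing on D, which becomes trivial in the quotient.\<close>

lemma character_pairing:
  assumes torsion: "\<And>(q::nat) a z. q > 0 \<Longrightarrow> a \<in> carrier A \<Longrightarrow>
      a [^]\<^bsub>A\<^esub> q \<in> derived A (carrier A) <#>\<^bsub>A\<^esub> \<iota> ` H \<Longrightarrow> z \<in> center B \<Longrightarrow> z [^]\<^bsub>B\<^esub> q \<in> H \<Longrightarrow>
      commutator A a (\<iota> (z [^]\<^bsub>B\<^esub> q)) = \<one>\<^bsub>A\<^esub>"
    and \<xi>: "\<xi> \<in> hom (A\<lparr>carrier := derived A (carrier A)\<rparr>) circle"
  shows "\<exists>\<beta>. (\<forall>z\<in>center B. (\<lambda>a. \<beta> a z) \<in> hom A circle) \<and>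
    (\<forall>a\<in>carrier A. \<beta> a \<in> hom (B\<lparr>carrier := center B\<rparr>) circle) \<and>
    (\<forall>h\<in>H. \<forall>z\<in>center B. \<beta> (\<iota> h) z = 1) \<and>
    (\<forall>a\<in>carrier A. \<forall>e\<in>H \<inter> center B. \<beta> a e = \<xi> (commutator A a (\<iota> e)))"
proof -
  define N where "N = derived A (carrier A) <#>\<^bsub>A\<^esub> \<iota> ` H"
  interpret N: normal N A unfolding N_def by (rule normal_derived_image)
  interpret M: comm_group "A Mod N" unfolding N_def by (rule comm_group_Mod_derived_image)
  interpret Z: comm_group "B\<lparr>carrier := center B\<rparr>" by (rule B.comm_group_center)
  have d: "commutator A a (\<iota> h) \<in> derived A (carrier A)" if "a \<in> carrier A" "h \<in> H" for a h
    using that by (simp add: A.commutator_in_derived)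
  have \<xi>_mult: "\<xi> (c \<otimes>\<^bsub>A\<^esub> c') = \<xi> c * \<xi> c'"
    if "c \<in> derived A (carrier A)" "c' \<in> derived A (carrier A)" for c c'
    using circle_hom_mult[OF \<xi>, of c c'] that by simp
  have \<xi>_norm: "norm (\<xi> c) = 1" if "c \<in> derived A (carrier A)" for c
    using circle_hom_norm[OF \<xi>, of c] that by simp
  have \<xi>_one: "\<xi> \<one>\<^bsub>A\<^esub> = 1"
    using group.circle_hom_one[OF A.subgroup_imp_group[OF subgroup_derived] \<xi>] by simp
  have "\<exists>b. b \<in> hom (A Mod N) circle \<and>
      (\<forall>a\<in>carrier A. b (N #>\<^bsub>A\<^esub> a) = \<xi> (commutator A a (\<iota> e)))" if e: "e \<in> H \<inter> center B" for e
  proof -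
    have h: "(\<lambda>a. \<xi> (commutator A a (\<iota> e))) \<in> hom A circle"
      using e by (intro circle_homI) (auto simp: d \<xi>_norm \<xi>_mult A.commutator_mult_left)
    have ker: "\<xi> (commutator A a (\<iota> e)) = \<one>\<^bsub>circle\<^esub>"
      if a: "a \<in> carrier A" and Na: "N #>\<^bsub>A\<^esub> a = \<one>\<^bsub>A Mod N\<^esub>" for a
    proof -
      have "a \<in> N" using A.coset_join1[of N a] Na a N.is_subgroup N.subset by simp
      then obtain c h where ch: "c \<in> derived A (carrier A)" "h \<in> H" "a = c \<otimes>\<^bsub>A\<^esub> \<iota> h"
        by (auto simp: N_def set_mult_def)
      have "commutator A c (\<iota> e) = \<one>\<^bsub>A\<^esub>"
        using ch e A.derived_central[of c "\<iota> e"] by (simp add: A.commutator_eq_one_iff)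
      then have "commutator A a (\<iota> e) = \<one>\<^bsub>A\<^esub>"
        using ch e by (simp add: A.commutator_mult_left \<iota>_central)
      then show ?thesis by (simp add: \<xi>_one)
    qed
    obtain b where b: "b \<in> hom ((A Mod N)\<lparr>carrier := (\<lambda>a. N #>\<^bsub>A\<^esub> a) ` carrier A\<rparr>) circle"
      "\<And>a. a \<in> carrier A \<Longrightarrow> b (N #>\<^bsub>A\<^esub> a) = \<xi> (commutator A a (\<iota> e))"
      by (rule hom_factor[OF A.is_group M.is_group circle.is_group N.r_coset_hom_Mod h ker])
        (assumption, assumption, rule that)
    have "(\<lambda>a. N #>\<^bsub>A\<^esub> a) ` carrier A = carrier (A Mod N)" by (auto simp: carrier_FactGroup)
    then show ?thesis using b by auto
  qed
  then obtain b where b: "\<And>e. e \<in> H \<inter> center B \<Longrightarrow> b e \<in> hom (A Mod N) circle"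
    "\<And>e a. e \<in> H \<inter> center B \<Longrightarrow> a \<in> carrier A \<Longrightarrow> b e (N #>\<^bsub>A\<^esub> a) = \<xi> (commutator A a (\<iota> e))"
    by metis
  \<comment> \<open>The arguments are reversed because b was chosen separately for each e as a
    character of the quotient; its multiplicativity in e is recovered from the values on
    cosets.\<close>
  interpret P: partial_pairing "A Mod N" "B\<lparr>carrier := center B\<rparr>" "H \<inter> center B" "\<lambda>X e. b e X"
  proof (intro partial_pairing.intro partial_pairing_axioms.intro M.comm_group_axioms Z.comm_group_axioms)
    show "subgroup (H \<inter> center B) (B\<lparr>carrier := center B\<rparr>)"
      by (intro B.subgroup_incl B.subgroups_Inter_pair H B.center_subgroup) simp
    show "(\<lambda>e. b e X) \<in> hom (B\<lparr>carrier := center B, carrier := H \<inter> center B\<rparr>) circle"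
      if "X \<in> carrier (A Mod N)" for X
    proof -
      obtain a where a: "a \<in> carrier A" "X = N #>\<^bsub>A\<^esub> a" using \<open>X \<in> _\<close> by (auto simp: carrier_FactGroup)
      show ?thesis
        using a by (intro circle_homI) (auto simp: b(2) d \<xi>_norm \<xi>_mult A.commutator_mult_right)
    qed
    show "(\<lambda>X. b e X) \<in> hom (A Mod N) circle" if "e \<in> H \<inter> center B" for e using b(1)[OF that] .
    show "b (w [^]\<^bsub>B\<lparr>carrier := center B\<rparr>\<^esub> q) X = 1"
      if q: "q > 0" and X: "X \<in> carrier (A Mod N)" and w: "w \<in> carrier (B\<lparr>carrier := center B\<rparr>)"
        and Xq: "X [^]\<^bsub>A Mod N\<^esub> q = \<one>\<^bsub>A Mod N\<^esub>"
        and wq: "w [^]\<^bsub>B\<lparr>carrier := center B\<rparr>\<^esub> q \<in> H \<inter> center B" for q :: nat and X w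
    proof -
      obtain a where a: "a \<in> carrier A" "X = N #>\<^bsub>A\<^esub> a" using X by (auto simp: carrier_FactGroup)
      have wq': "w [^]\<^bsub>B\<lparr>carrier := center B\<rparr>\<^esub> q = w [^]\<^bsub>B\<^esub> q"
        by (rule B.nat_pow_consistent[symmetric])
      have "N #>\<^bsub>A\<^esub> (a [^]\<^bsub>A\<^esub> q) = N" using Xq a by (simp add: N.FactGroup_pow)
      then have "a [^]\<^bsub>A\<^esub> q \<in> N"
        using A.coset_join1[of N "a [^]\<^bsub>A\<^esub> q"] a N.is_subgroup N.subset by simp
      then have "commutator A a (\<iota> (w [^]\<^bsub>B\<^esub> q)) = \<one>\<^bsub>A\<^esub>"
        using torsion[of q a w] q a w wq wq' by (simp add: N_def)
      then show ?thesis using b(2)[OF wq a(1)] a wq' by (simp add: \<xi>_one)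
    qed
  qed
  obtain \<beta> where \<beta>: "\<And>X. X \<in> carrier (A Mod N) \<Longrightarrow> \<beta> X \<in> hom (B\<lparr>carrier := center B\<rparr>) circle"
    "\<And>z. z \<in> center B \<Longrightarrow> (\<lambda>X. \<beta> X z) \<in> hom (A Mod N) circle"
    "\<And>X e. X \<in> carrier (A Mod N) \<Longrightarrow> e \<in> H \<inter> center B \<Longrightarrow> \<beta> X e = b e X"
    using P.extend by (metis partial_object.select_convs(1) partial_object.surjective partial_object.update_convs(1))
  have coset: "N #>\<^bsub>A\<^esub> a \<in> carrier (A Mod N)" if "a \<in> carrier A" for a
    using that by (auto simp: carrier_FactGroup)
  have "N #>\<^bsub>A\<^esub> \<iota> h = \<one>\<^bsub>A Mod N\<^esub>" if "h \<in> H" for h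
    using that image_in_derived_image A.coset_join2[of "\<iota> h" N] N.is_subgroup
    by (auto simp: N_def)
  then have 1: "\<beta> (N #>\<^bsub>A\<^esub> \<iota> h) z = 1" if "h \<in> H" "z \<in> center B" for h z
    using M.circle_hom_one[OF \<beta>(2)] that by simp
  have 2: "(\<lambda>a. \<beta> (N #>\<^bsub>A\<^esub> a) z) \<in> hom A circle" if "z \<in> center B" for z
    using hom_compose[OF N.r_coset_hom_Mod \<beta>(2)[OF that]] by (simp add: comp_def)
  show ?thesis
    using \<beta>(1,3) 1 2 coset b(2) by (intro exI[of _ "\<lambda>a z. \<beta> (N #>\<^bsub>A\<^esub> a) z"]) auto
qed

text \<open>The pairings for different characters \<xi> are chosen with no compatibility between
  them: T has one coordinate for each \<xi>, \<phi> c is the family of values \<xi> c, and every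
  requirement on \<beta> in \<open>amalgam_data\<close> can be checked coordinate by
  coordinate.\<close>

lemma amalgam_of_torsion_condition:
  assumes torsion: "\<And>(q::nat) a z. q > 0 \<Longrightarrow> a \<in> carrier A \<Longrightarrow>
      a [^]\<^bsub>A\<^esub> q \<in> derived A (carrier A) <#>\<^bsub>A\<^esub> \<iota> ` H \<Longrightarrow> z \<in> center B \<Longrightarrow> z [^]\<^bsub>B\<^esub> q \<in> H \<Longrightarrow>
      commutator A a (\<iota> (z [^]\<^bsub>B\<^esub> q)) = \<one>\<^bsub>A\<^esub>"
  obtains G :: "('a \<times> (('a \<Rightarrow> complex) \<Rightarrow> complex) \<times> 'b) set monoid" and f g
  where "nilpotent_class2 G" "f \<in> mon A G" "g \<in> mon B G" "\<And>h. h \<in> H \<Longrightarrow> f (\<iota> h) = g h"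
proof -
  let ?A2 = "A\<lparr>carrier := derived A (carrier A)\<rparr>"
  define \<Xi> where "\<Xi> = hom ?A2 circle"
  define T where "T = product_group \<Xi> (\<lambda>_. circle)"
  have "\<forall>\<xi>\<in>\<Xi>. \<exists>\<beta>. (\<forall>z\<in>center B. (\<lambda>a. \<beta> a z) \<in> hom A circle) \<and>
    (\<forall>a\<in>carrier A. \<beta> a \<in> hom (B\<lparr>carrier := center B\<rparr>) circle) \<and>
    (\<forall>h\<in>H. \<forall>z\<in>center B. \<beta> (\<iota> h) z = 1) \<and>
    (\<forall>a\<in>carrier A. \<forall>e\<in>H \<inter> center B. \<beta> a e = \<xi> (commutator A a (\<iota> e)))"
    using character_pairing[OF torsion] unfolding \<Xi>_def by blast
  then obtain \<beta> where \<beta>: "\<forall>\<xi>\<in>\<Xi>. (\<forall>z\<in>center B. (\<lambda>a. \<beta> \<xi> a z) \<in> hom A circle) \<and>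
    (\<forall>a\<in>carrier A. \<beta> \<xi> a \<in> hom (B\<lparr>carrier := center B\<rparr>) circle) \<and>
    (\<forall>h\<in>H. \<forall>z\<in>center B. \<beta> \<xi> (\<iota> h) z = 1) \<and>
    (\<forall>a\<in>carrier A. \<forall>e\<in>H \<inter> center B. \<beta> \<xi> a e = \<xi> (commutator A a (\<iota> e)))"
    by (rule bchoice[THEN exE])
  have \<beta>_norm: "norm (\<beta> \<xi> a z) = 1" if "\<xi> \<in> \<Xi>" "a \<in> carrier A" "z \<in> center B" for \<xi> a z
    using \<beta> that circle_hom_norm[of "\<lambda>a. \<beta> \<xi> a z" A a] by blast
  have \<beta>_left: "\<beta> \<xi> (a \<otimes>\<^bsub>A\<^esub> a') z = \<beta> \<xi> a z * \<beta> \<xi> a' z"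
    if "\<xi> \<in> \<Xi>" "a \<in> carrier A" "a' \<in> carrier A" "z \<in> center B" for \<xi> a a' z
    using \<beta> that circle_hom_mult[of "\<lambda>a. \<beta> \<xi> a z" A a a'] by blast
  have \<beta>_right: "\<beta> \<xi> a (z \<otimes>\<^bsub>B\<^esub> z') = \<beta> \<xi> a z * \<beta> \<xi> a z'"
    if "\<xi> \<in> \<Xi>" "a \<in> carrier A" "z \<in> center B" "z' \<in> center B" for \<xi> a z z'
    using \<beta> that circle_hom_mult[of "\<beta> \<xi> a" "B\<lparr>carrier := center B\<rparr>" z z'] by simp
  have \<xi>_norm: "norm (\<xi> c) = 1" if "\<xi> \<in> \<Xi>" "c \<in> derived A (carrier A)" for \<xi> c
    using circle_hom_norm[of \<xi> ?A2 c] that by (simp add: \<Xi>_def)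
  have \<xi>_mult: "\<xi> (c \<otimes>\<^bsub>A\<^esub> c') = \<xi> c * \<xi> c'"
    if "\<xi> \<in> \<Xi>" "c \<in> derived A (carrier A)" "c' \<in> derived A (carrier A)" for \<xi> c c'
    using circle_hom_mult[of \<xi> ?A2 c c'] that by (simp add: \<Xi>_def)
  define \<phi> where "\<phi> c = (\<lambda>\<xi>\<in>\<Xi>. \<xi> c)" for c
  have gT: "group T" unfolding T_def by (intro product_group circle.is_group)
  have T: "comm_group T"
    by (rule group.group_comm_groupI[OF gT]) (auto simp: T_def mult.commute)
  have A2: "comm_group ?A2"
    using A.subgroup_imp_group[OF subgroup_derived] A.derived_central
    by (intro group.group_comm_groupI) auto
  have \<phi>: "\<phi> \<in> hom ?A2 T"
    by (rule homI) (auto simp: T_def \<phi>_def \<xi>_norm \<xi>_mult intro!: restrict_ext)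
  interpret \<phi>: group_hom ?A2 T \<phi>
    using \<phi> A2 gT by (simp add: group_hom_def group_hom_axioms_def comm_group_def)
  have "c = \<one>\<^bsub>A\<^esub>" if c: "c \<in> derived A (carrier A)" "\<phi> c = \<one>\<^bsub>T\<^esub>" for c
  proof (rule ccontr)
    assume "c \<noteq> \<one>\<^bsub>A\<^esub>"
    then obtain \<xi> where "\<xi> \<in> \<Xi>" "\<xi> c \<noteq> 1"
      using comm_group.circle_hom_separates[OF A2, of c] c unfolding \<Xi>_def by auto
    then show False using fun_cong[OF c(2), of \<xi>] by (simp add: \<phi>_def T_def)
  qed
  then have \<phi>_inj: "inj_on \<phi> (derived A (carrier A))" using \<phi>.inj_on_one_iff by auto
  have data: "amalgam_data A B H \<iota> T \<phi> (\<lambda>a z. \<lambda>\<xi>\<in>\<Xi>. \<beta> \<xi> a z)"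
  proof (intro amalgam_data.intro amalgam_data_axioms.intro cocentral_amalgam_axioms T \<phi> \<phi>_inj)
    show "(\<lambda>a. \<lambda>\<xi>\<in>\<Xi>. \<beta> \<xi> a z) \<in> hom A T" if "z \<in> center B" for z
      using that by (intro homI) (auto simp: T_def \<beta>_norm \<beta>_left intro!: restrict_ext)
    show "(\<lambda>z. \<lambda>\<xi>\<in>\<Xi>. \<beta> \<xi> a z) \<in> hom (B\<lparr>carrier := center B\<rparr>) T" if "a \<in> carrier A" for a
      using that by (intro homI) (auto simp: T_def \<beta>_norm \<beta>_right intro!: restrict_ext)
    show "(\<lambda>\<xi>\<in>\<Xi>. \<beta> \<xi> (\<iota> h) z) = \<one>\<^bsub>T\<^esub>" if "h \<in> H" "z \<in> center B" for h z
      using that \<beta> by (auto simp: T_def intro!: restrict_ext)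
    show "(\<lambda>\<xi>\<in>\<Xi>. \<beta> \<xi> a e) = \<phi> (commutator A a (\<iota> e))"
      if "a \<in> carrier A" "e \<in> H" "e \<in> center B" for a e
      using that \<beta> by (auto simp: \<phi>_def intro!: restrict_ext)
  qed
  show ?thesis by (rule amalgam_data.amalgam[OF data]) (rule that)
qed

end

section \<open>Necessity of the condition, and the equivalence\<close>

lemma torsion_condition_of_weak_amalgam:
  assumes B: "group B" and i: "i \<in> hom D A" and j: "j \<in> hom D B" and A: "group A"
    and am: "weak_amalgam A B D i j G f g"
    and a: "a \<in> carrier A" "a [^]\<^bsub>A\<^esub> (q::nat) \<in> derived A (carrier A) <#>\<^bsub>A\<^esub> (i ` carrier D)"
    and z: "z \<in> center B" "d \<in> carrier D" "z [^]\<^bsub>B\<^esub> q = j d"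
  shows "commutator A a (i d) = \<one>\<^bsub>A\<^esub>"
proof -
  have G: "nilpotent_class2 G" and f: "f \<in> hom A G" "inj_on f (carrier A)" and g: "g \<in> hom B G"
    and fg: "\<And>d. d \<in> carrier D \<Longrightarrow> f (i d) = g (j d)"
    using am by (auto simp: weak_amalgam_def mon_def)
  interpret A: group A by fact
  interpret B: group B by fact
  interpret G: class2_group G
    using G by (simp add: class2_group_def class2_group_axioms_def nilpotent_class2_def)
  interpret f: group_hom A G f
    using f A.is_group G.is_group by (simp add: group_hom_def group_hom_axioms_def)
  interpret g: group_hom B G g
    using g B.is_group G.is_group by (simp add: group_hom_def group_hom_axioms_def)
  have zB: "z \<in> carrier B" using z B.center_subset by blast
  have iD: "i d \<in> carrier A" if "d \<in> carrier D" for d using hom_in_carrier[OF i that] .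
  have jD: "j d \<in> carrier B" if "d \<in> carrier D" for d using hom_in_carrier[OF j that] .
  obtain c d0 where c: "c \<in> derived A (carrier A)" and d0: "d0 \<in> carrier D"
    and aq: "a [^]\<^bsub>A\<^esub> q = c \<otimes>\<^bsub>A\<^esub> i d0" using a(2) by (auto simp: set_mult_def)
  have cA: "c \<in> carrier A" using c A.derived_in_carrier[of "carrier A"] by blast
  have "f c \<in> derived G (f ` carrier A)" using c f.derived_img[of "carrier A"] by blast
  moreover have "f ` carrier A \<subseteq> carrier G" by auto
  ultimately have "f c \<in> derived G (carrier G)"
    using G.mono_derived by blast
  then have fc: "commutator G (f c) (g z) = \<one>\<^bsub>G\<^esub>"
    using G.derived_central[of "f c" "g z"] cA zB by (simp add: G.commutator_eq_one_iff)
  \<comment> \<open>z is central in B but in general not in G: it is known to commute with the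
    images of D and of \<open>A\<^sub>2\<close>, not with a. Hence the exponent is moved from z to a
    below.\<close>
  have "z \<otimes>\<^bsub>B\<^esub> j d0 = j d0 \<otimes>\<^bsub>B\<^esub> z" using z(1) jD[OF d0] by (rule B.center_commutes)
  then have "g z \<otimes>\<^bsub>G\<^esub> g (j d0) = g (j d0) \<otimes>\<^bsub>G\<^esub> g z"
    using zB jD[OF d0] by (metis g.hom_mult)
  then have gd0: "commutator G (g (j d0)) (g z) = \<one>\<^bsub>G\<^esub>"
    using zB jD[OF d0] by (simp add: G.commutator_eq_one_iff)
  have "f (commutator A a (i d)) = commutator G (f a) (g (j d))"
    using a(1) iD[OF z(2)] by (simp add: commutator_def fg[OF z(2)])
  also have "\<dots> = commutator G (f a) (g z [^]\<^bsub>G\<^esub> q)"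
    using zB by (simp add: g.hom_nat_pow flip: z(3))
  also have "\<dots> = commutator G (f a [^]\<^bsub>G\<^esub> q) (g z)"
    using a(1) zB by (simp add: G.commutator_nat_pow_left G.commutator_nat_pow_right)
  also have "f a [^]\<^bsub>G\<^esub> q = f c \<otimes>\<^bsub>G\<^esub> g (j d0)"
    using a(1) cA iD[OF d0] aq f.hom_nat_pow[of a q] by (simp add: fg[OF d0])
  also have "commutator G (f c \<otimes>\<^bsub>G\<^esub> g (j d0)) (g z) = \<one>\<^bsub>G\<^esub>"
    using cA zB jD[OF d0] by (simp add: G.commutator_mult_left fc gd0)
  finally have "f (commutator A a (i d)) = f \<one>\<^bsub>A\<^esub>" by simp
  then show ?thesis using inj_onD[OF f(2)] a(1) iD[OF z(2)] by simp
qed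

theorem theorem5:
  fixes A :: "('a, 'r) monoid_scheme" and B :: "('b, 's) monoid_scheme"
    and D :: "('d, 't) monoid_scheme" and i :: "'d \<Rightarrow> 'a" and j :: "'d \<Rightarrow> 'b"
  assumes "nilpotent_class2 A" and "nilpotent_class2 B" and "group D"
    and "i \<in> mon D A" and "j \<in> mon D B"
    and "cocentral (j ` carrier D) B"
  shows "amalgam_exists A B D i j \<longleftrightarrow>
    (\<forall>q::nat. q > 0 \<longrightarrow>
      (\<forall>a\<in>carrier A. a [^]\<^bsub>A\<^esub> q \<in> derived A (carrier A) <#>\<^bsub>A\<^esub> (i ` carrier D) \<longrightarrow>
        (\<forall>z\<in>center B. \<forall>d\<in>carrier D. z [^]\<^bsub>B\<^esub> q = j d \<longrightarrow>
          commutator A a (i d) = \<one>\<^bsub>A\<^esub>)))"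
proof -
  interpret A: class2_group A
    using assms(1) by (simp add: class2_group_def class2_group_axioms_def nilpotent_class2_def)
  interpret B: class2_group B
    using assms(2) by (simp add: class2_group_def class2_group_axioms_def nilpotent_class2_def)
  interpret D: group D by fact
  have i: "i \<in> hom D A" "inj_on i (carrier D)" and j: "j \<in> hom D B" "inj_on j (carrier D)"
    using assms by (simp_all add: mon_def)
  interpret j: group_hom D B j
    using j by (simp add: group_hom_def group_hom_axioms_def D.is_group B.is_group)
  show ?thesis
  proof (intro iffI allI impI ballI)
    fix q :: nat and a z d
    assume "amalgam_exists A B D i j"
    then obtain G :: "('a + 'b) list monoid" and f g where "weak_amalgam A B D i j G f g"
      by (auto simp: amalgam_exists_def)
    moreover assume "a \<in> carrier A" "a [^]\<^bsub>A\<^esub> q \<in> derived A (carrier A) <#>\<^bsub>A\<^esub> i ` carrier D"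
      "z \<in> center B" "d \<in> carrier D" "z [^]\<^bsub>B\<^esub> q = j d"
    ultimately show "commutator A a (i d) = \<one>\<^bsub>A\<^esub>"
      using torsion_condition_of_weak_amalgam[OF B.is_group i(1) j(1) A.is_group] by blast
  next
    assume cond: "\<forall>q::nat. q > 0 \<longrightarrow>
      (\<forall>a\<in>carrier A. a [^]\<^bsub>A\<^esub> q \<in> derived A (carrier A) <#>\<^bsub>A\<^esub> (i ` carrier D) \<longrightarrow>
        (\<forall>z\<in>center B. \<forall>d\<in>carrier D. z [^]\<^bsub>B\<^esub> q = j d \<longrightarrow>
          commutator A a (i d) = \<one>\<^bsub>A\<^esub>))"
    define H where "H = j ` carrier D"
    \<comment> \<open>The locale works with an actual subgroup of B, so D is moved into B along j,
      and its embedding into A has to undo j first.\<close>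
    define \<iota> where "\<iota> h = i (inv_into (carrier D) j h)" for h
    have \<iota>j: "\<iota> (j d) = i d" if "d \<in> carrier D" for d
      using that j(2) by (simp add: \<iota>_def)
    have H: "subgroup H B" unfolding H_def by (rule j.img_is_subgroup)
    have \<iota>_hom: "\<iota> \<in> hom (B\<lparr>carrier := H\<rparr>) A"
    proof (rule homI)
      fix x y assume "x \<in> carrier (B\<lparr>carrier := H\<rparr>)" "y \<in> carrier (B\<lparr>carrier := H\<rparr>)"
      then obtain c d where "c \<in> carrier D" "d \<in> carrier D" "x = j c" "y = j d" by (auto simp: H_def)
      then show "\<iota> (x \<otimes>\<^bsub>B\<lparr>carrier := H\<rparr>\<^esub> y) = \<iota> x \<otimes>\<^bsub>A\<^esub> \<iota> y"
        using hom_mult[OF i(1), of c d] by (simp add: \<iota>j flip: j.hom_mult)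
    qed (auto simp: H_def \<iota>j hom_in_carrier[OF i(1)])
    have \<iota>_inj: "inj_on \<iota> H"
      using i(2) by (auto simp: inj_on_def H_def \<iota>j)
    have \<iota>H: "\<iota> ` H = i ` carrier D" by (auto simp: H_def \<iota>j image_image)
    interpret cocentral_amalgam A B H \<iota>
      using B.cocentral_set_mult_center[OF H] assms(6)
      by (intro cocentral_amalgam.intro cocentral_amalgam_axioms.intro A.class2_group_axioms
          B.class2_group_axioms H \<iota>_hom \<iota>_inj) (simp add: H_def)
    have torsion: "commutator A a (\<iota> (z [^]\<^bsub>B\<^esub> q)) = \<one>\<^bsub>A\<^esub>"
      if "q > 0" "a \<in> carrier A" "a [^]\<^bsub>A\<^esub> q \<in> derived A (carrier A) <#>\<^bsub>A\<^esub> \<iota> ` H" "z \<in> center B"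
        and zq: "z [^]\<^bsub>B\<^esub> q \<in> H" for q :: nat and a z
    proof -
      obtain d where d: "d \<in> carrier D" "z [^]\<^bsub>B\<^esub> q = j d" using zq by (auto simp: H_def)
      then show ?thesis using cond that by (simp add: \<iota>j \<iota>H)
    qed
    obtain G :: "('a \<times> (('a \<Rightarrow> complex) \<Rightarrow> complex) \<times> 'b) set monoid" and f g
      where "nilpotent_class2 G" "f \<in> mon A G" "g \<in> mon B G" "\<And>h. h \<in> H \<Longrightarrow> f (\<iota> h) = g h"
      using amalgam_of_torsion_condition[OF torsion] by blast
    then have "weak_amalgam A B D i j G f g"
      by (auto simp: weak_amalgam_def H_def simp flip: \<iota>j)
    \<comment> \<open>The amalgam obtained consists of cosets of triples; rewriting its elements as
      words over A and B brings it into the type fixed by \<open>amalgam_exists\<close>.\<close>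
    then show "amalgam_exists A B D i j"
      by (rule amalgam_existsI[OF A.is_group B.is_group assms(4,5)])
  qed
qed

end
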